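(* Let $g\ge 3$ be an integer and let $\mathcal G_g$ be the set of all weighted multigraphs $\Gamma=(V,E,g_\Gamma)$ of genus $g$ such that $2g_\Gamma(v)-2+d(v)>0$ for every $v\in V$. If $\Gamma\in\mathcal G_g$ has maximal complexity, i.e. $c(\Gamma)\ge c(\Gamma')$ for every $\Gamma'\in\mathcal G_g$, then $\Gamma$ is trivalent, simple and $2$-connected.
   Context: A weighted multigraph is a triple $(V,E,g_\Gamma)$ with $V$ a finite set of vertices, $E$ a finite set of edges (multiple edges and loops allowed), and $g_\Gamma:V\to\mathbb Z_{\ge 0}$ a weight function. Its genus is $\sum_{v\in V}g_\Gamma(v)+b_1(\Gamma)$, where $b_1(\Gamma)=|E|-|V|+(\text{number of connected components})$. The degree $d(v)$ is the number of half-edges at $v$ (a loop counts twice). The complexity $c(\Gamma)$ is the number of spanning trees of $\Gamma$ (so $c(\Gamma)=0$ iff $\Gamma$ is disconnected). A graph is trivalent if all vertices have degree 3; simple if it has no loops and no multiple edges; $k$-connected if for any set $S$ of $k-1$ edges, the graph $\Gamma\setminus S$ obtained by removing the edges of $S$ is still connected. *)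

theory Defs
  imports Complex_Main "HOL-Library.Multiset"
begin

text \<open>
  An edge \<open>e\<close> carries the two-element multiset \<open>ends e\<close> of its end points, so
  \<open>ends e = {#v, v#}\<close> for a loop at \<open>v\<close>, and parallel edges are distinct edges with the
  same value of \<open>ends\<close>.  The functions \<open>ends\<close> and \<open>weight\<close> are only relevant on \<open>edges\<close>
  and \<open>verts\<close>.
\<close>

record ('v, 'e) wmgraph =
  verts :: "'v set"
  edges :: "'e set"
  ends :: "'e \<Rightarrow> 'v multiset"
  weight :: "'v \<Rightarrow> nat"

locale weighted_multigraph =
  fixes G :: "('v, 'e) wmgraph"
  assumes finite_verts: "finite (verts G)"
    and finite_edges: "finite (edges G)"
    and size_ends: "e \<in> edges G \<Longrightarrow> size (ends G e) = 2"
    and ends_in_verts: "e \<in> edges G \<Longrightarrow> set_mset (ends G e) \<subseteq> verts G"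

definition degree :: "('v, 'e) wmgraph \<Rightarrow> 'v \<Rightarrow> nat" where
  "degree G v = (\<Sum>e\<in>edges G. count (ends G e) v)"

definition adj :: "('v, 'e) wmgraph \<Rightarrow> ('v \<times> 'v) set" where
  "adj G = {(u, v). \<exists>e\<in>edges G. ends G e = {#u, v#}}"

definition reachable :: "('v, 'e) wmgraph \<Rightarrow> ('v \<times> 'v) set" where
  "reachable G = (adj G)\<^sup>* \<inter> verts G \<times> verts G"

definition components :: "('v, 'e) wmgraph \<Rightarrow> 'v set set" where
  "components G = verts G // reachable G"

definition graph_connected :: "('v, 'e) wmgraph \<Rightarrow> bool" where
  "graph_connected G \<longleftrightarrow> card (components G) = 1"

definition betti :: "('v, 'e) wmgraph \<Rightarrow> int" where
  "betti G = int (card (edges G)) - int (card (verts G)) + int (card (components G))"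

definition genus :: "('v, 'e) wmgraph \<Rightarrow> int" where
  "genus G = int (\<Sum>v\<in>verts G. weight G v) + betti G"

text \<open>
  A cycle runs through the distinct vertices \<open>vs\<close> in cyclic order along the distinct edges
  \<open>es\<close>.  Length 1 is a loop, length 2 a pair of parallel edges.
\<close>

definition is_cycle :: "('v, 'e) wmgraph \<Rightarrow> 'v list \<Rightarrow> 'e list \<Rightarrow> bool" where
  "is_cycle G vs es \<longleftrightarrow>
     es \<noteq> [] \<and> length vs = length es \<and> distinct vs \<and> distinct es \<and>
     set vs \<subseteq> verts G \<and> set es \<subseteq> edges G \<and>
     (\<forall>i<length es. ends G (es ! i) = {#vs ! i, vs ! (Suc i mod length vs)#})"

definition is_tree :: "('v, 'e) wmgraph \<Rightarrow> bool" where
  "is_tree G \<longleftrightarrow> graph_connected G \<and> \<not> (\<exists>vs es. is_cycle G vs es)"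

text \<open>A spanning tree contains all vertices, so it is given by its set of edges.\<close>

definition spanning_trees :: "('v, 'e) wmgraph \<Rightarrow> 'e set set" where
  "spanning_trees G = {T. T \<subseteq> edges G \<and> is_tree (G\<lparr>edges := T\<rparr>)}"

definition complexity :: "('v, 'e) wmgraph \<Rightarrow> nat" where
  "complexity G = card (spanning_trees G)"

definition trivalent :: "('v, 'e) wmgraph \<Rightarrow> bool" where
  "trivalent G \<longleftrightarrow> (\<forall>v\<in>verts G. degree G v = 3)"

definition simple_graph :: "('v, 'e) wmgraph \<Rightarrow> bool" where
  "simple_graph G \<longleftrightarrow> (\<forall>e\<in>edges G. \<forall>v. ends G e \<noteq> {#v, v#}) \<and> inj_on (ends G) (edges G)"

definition delete_edges :: "('v, 'e) wmgraph \<Rightarrow> 'e set \<Rightarrow> ('v, 'e) wmgraph" where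
  "delete_edges G S = G\<lparr>edges := edges G - S\<rparr>"

text \<open>This is connectivity with respect to edge deletion.\<close>

definition k_connected :: "nat \<Rightarrow> ('v, 'e) wmgraph \<Rightarrow> bool" where
  "k_connected k G \<longleftrightarrow>
     (\<forall>S\<subseteq>edges G. card S = k - 1 \<longrightarrow> graph_connected (delete_edges G S))"

definition stable_graphs :: "int \<Rightarrow> ('v, 'e) wmgraph set" where
  "stable_graphs g =
     {G. weighted_multigraph G \<and> genus G = g \<and>
         (\<forall>v\<in>verts G. 2 * int (weight G v) - 2 + int (degree G v) > 0)}"

end

theory Submission
  imports Defs
begin

text \<open>
  Call \<open>2 g(v) - 2 + d(v)\<close> the excess of \<open>v\<close>.  Contracting a bridge changes neither genus nor
  complexity and adds up excesses; trading a unit of weight for a loop preserves excess and genus and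
  does not lower the complexity.  If \<open>v\<close> has excess at least 2 and carries a loop or lies on a cycle,
  then \<open>v\<close> can be split into two vertices joined by a new edge that is not a bridge, and deletion and
  contraction of this edge show that the complexity grows.  By induction on the number of edges, all
  excesses in a maximal graph are 1, so there is no bridge, no weight and no loop, and the graph is
  trivalent.

  Two parallel edges \<open>e1\<close>, \<open>e2\<close> between \<open>u\<close> and \<open>v\<close> are excluded by a Whitehead move on
  the third edge \<open>ux\<close> at \<open>u\<close>: the end of \<open>e1\<close> at \<open>u\<close> is exchanged with an end at \<open>x\<close>.
  The contractions of \<open>ux\<close> agree, and the deletion of \<open>ux\<close> gains spanning trees by an
  explicit injection.
\<close>

section \<open>Connectivity and spanning trees\<close>

text \<open>For a connected graph the excesses sum to 2g - 2, so splitting moves towards the 2g - 2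
  vertices of a trivalent graph without weights. The obstacle is that the edge created by a split
  may be a bridge, and then nothing is gained. A loop at the vertex prevents this. Without loops, a
  non-bridge \<open>e\<close> at the vertex can be split off together with either of two further
  edges, and if both choices failed, \<open>e\<close> would be a bridge after all. A bridge is
  contracted instead: the result is still maximal, has a vertex of excess at least 2, and has fewer
  edges. Splits enlarge the graph but contradict maximality at once, so only contractions feed the
  induction. The bound g >= 3 excludes the theta graph, two vertices joined by three edges, which
  has genus 2 and parallel edges. Two matters of formulation remain: the class also contains
  disconnected graphs, and the competitors are labelled by natural numbers. A one-vertex graph and a
  relabelling deal with them.\<close>

definition edge_const :: "('e \<Rightarrow> 'v multiset) \<Rightarrow> 'e set \<Rightarrow> ('v \<Rightarrow> bool) \<Rightarrow> bool" where
  "edge_const f T P \<longleftrightarrow> (\<forall>e\<in>T. \<forall>x\<in># f e. \<forall>y\<in># f e. P x = P y)"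

text \<open>Connectivity by cuts: every two-colouring that is constant on edges is constant.  Unlike paths,
  this transfers to contractions and splittings by composition.\<close>

definition con :: "'v set \<Rightarrow> ('e \<Rightarrow> 'v multiset) \<Rightarrow> 'e set \<Rightarrow> bool" where
  "con V f T \<longleftrightarrow> V \<noteq> {} \<and> (\<forall>P. edge_const f T P \<longrightarrow> (\<forall>x\<in>V. \<forall>y\<in>V. P x = P y))"

text \<open>A connected spanning edge set is acyclic exactly when it has |V| - 1 edges, so counting
  edges replaces cycles in all later arguments. The link to the given notion is
  \<open>complexity_eq\<close>.\<close>

definition trees :: "'v set \<Rightarrow> ('e \<Rightarrow> 'v multiset) \<Rightarrow> 'e set \<Rightarrow> 'e set set" where
  "trees V f E = {T. T \<subseteq> E \<and> con V f T \<and> card T + 1 = card V}"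

lemma size_mset_2:
  assumes "size M = 2" obtains a b where "M = {#a, b#}"
proof -
  obtain a N where "M = add_mset a N" "size N = 1"
    using assms size_eq_Suc_imp_eq_union[of M 1] by auto
  then show thesis using that size_1_singleton_mset[of N] by auto
qed

lemma edge_const_insert:
  assumes "f e = {#a, b#}"
  shows "edge_const f (insert e T) P \<longleftrightarrow> P a = P b \<and> edge_const f T P"
  using assms by (auto simp: edge_const_def)

lemma edge_const_edge: "edge_const f T P \<Longrightarrow> e \<in> T \<Longrightarrow> f e = {#a, b#} \<Longrightarrow> P a = P b"
  by (auto simp: edge_const_def)

lemma edge_const_mono: "edge_const f T P \<Longrightarrow> S \<subseteq> T \<Longrightarrow> edge_const f S P"
  by (auto simp: edge_const_def)

text \<open>Colourings pull back along a vertex map; this is the composition argument behind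
  contraction.\<close>

lemma edge_const_comp: "edge_const f T (\<lambda>x. P (m x)) \<longleftrightarrow> edge_const (\<lambda>e. image_mset m (f e)) T P"
  by (auto simp: edge_const_def)

lemma conD: "con V f T \<Longrightarrow> edge_const f T P \<Longrightarrow> x \<in> V \<Longrightarrow> y \<in> V \<Longrightarrow> P x = P y"
  unfolding con_def by blast

lemma conI:
  assumes "a \<in> V" "\<And>P x. edge_const f T P \<Longrightarrow> x \<in> V \<Longrightarrow> P x = P a"
  shows "con V f T"
  unfolding con_def using assms by blast

lemma con_mono: "con V f S \<Longrightarrow> S \<subseteq> T \<Longrightarrow> con V f T"
  unfolding con_def using edge_const_mono by blast

lemma con_weaken: "con V f T \<Longrightarrow> (\<And>P. edge_const f S P \<Longrightarrow> edge_const f T P) \<Longrightarrow> con V f S"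
  unfolding con_def by simp

lemma edge_const_cong:
  assumes "\<And>e. e \<in> T \<Longrightarrow> f e = g e" shows "edge_const f T P = edge_const g T P"
  using assms by (auto simp: edge_const_def)

lemma con_cong:
  assumes "\<And>e. e \<in> T \<Longrightarrow> f e = g e" shows "con V f T = con V g T"
  using edge_const_cong[of T f g, OF assms] unfolding con_def by simp

lemma trees_cong:
  assumes "\<And>e. e \<in> E \<Longrightarrow> f e = g e" shows "trees V f E = trees V g E"
proof -
  have "T \<subseteq> E \<Longrightarrow> con V f T = con V g T" for T
    by (rule con_cong) (use assms in auto)
  then show ?thesis unfolding trees_def by auto
qed

text \<open>Colourings of the quotient are the same as colourings with equal values at
  \<open>u\<close> and \<open>v\<close>: composing with \<open>id(v := u)\<close> leaves such a
  colouring unchanged, and every colouring of the quotient pulls back to one.\<close>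

lemma con_contract:
  assumes e: "f e = {#u, v#}" and uv: "u \<in> V" "u \<noteq> v"
  shows "con V f (insert e T) \<longleftrightarrow> con (V - {v}) (\<lambda>x. image_mset (id(v := u)) (f x)) T"
    (is "_ \<longleftrightarrow> con _ ?g _")
proof
  assume c: "con V f (insert e T)"
  show "con (V - {v}) ?g T"
  proof (rule conI[of u])
    show "u \<in> V - {v}" using uv by auto
    fix P x assume P: "edge_const ?g T P" and x: "x \<in> V - {v}"
    have "edge_const f (insert e T) (\<lambda>z. P ((id(v := u)) z))"
      using P uv unfolding edge_const_insert[of f e u v, OF e]
      by (subst edge_const_comp) simp
    from conD[OF c this, of x u] show "P x = P u" using x uv by auto
  qed
next
  assume c: "con (V - {v}) ?g T"
  show "con V f (insert e T)"
  proof (rule conI[of u])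
    show "u \<in> V" by fact
    fix P x assume "edge_const f (insert e T) P" and x: "x \<in> V"
    then have P: "P u = P v" "edge_const f T P" by (auto simp: edge_const_insert[of f e u v, OF e])
    have "(\<lambda>z. P ((id(v := u)) z)) = P" using P(1) by auto
    with P(2) have "edge_const ?g T P" unfolding edge_const_comp[of f T P, symmetric] by simp
    from conD[OF c this, of x u] show "P x = P u" using x uv P(1) by (cases "x = v") auto
  qed
qed

section \<open>Existence of spanning trees; deletion and contraction\<close>

lemma con_card_1:
  assumes "con V f T" "card V = 1" shows "con V f {}"
  using assms by (auto simp: con_def card_1_singleton_iff)

text \<open>The cut around \<open>u\<close> alone must be crossed by an edge.\<close>

lemma con_nonloop_edge:
  assumes "con V f T" "u \<in> V" "w \<in> V" "u \<noteq> w" and sz: "\<And>e. e \<in> T \<Longrightarrow> size (f e) = 2"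
  obtains e v where "e \<in> T" "f e = {#u, v#}" "u \<noteq> v"
proof -
  have "\<not> edge_const f T (\<lambda>x. x = u)" using conD[OF assms(1), of "\<lambda>x. x = u" w u] assms by auto
  then obtain e x y where e: "e \<in> T" and xy: "x \<in># f e" "y \<in># f e" "(x = u) \<noteq> (y = u)"
    unfolding edge_const_def by blast
  obtain a b where ab: "f e = {#a, b#}" using size_mset_2[OF sz[OF e]] .
  show thesis
  proof (cases "a = u")
    case True then show thesis using that[of e b] e ab xy by auto
  next
    case False then show thesis using that[of e a] e ab xy by (auto simp: add_mset_commute)
  qed
qed

text \<open>Induction on the number of vertices: contract a non-loop edge, apply the hypothesis to
  the quotient, and put the edge back into the tree found there. The lower bound on the number of
  edges falls out of the same induction.\<close>

lemma con_spanning_tree_aux: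
  assumes "finite V" "finite T" "con V f T" and sz: "\<And>e. e \<in> T \<Longrightarrow> size (f e) = 2 \<and> set_mset (f e) \<subseteq> V"
  shows "card V \<le> card T + 1 \<and> (\<exists>S\<subseteq>T. con V f S \<and> card S + 1 = card V)"
  using assms
proof (induction "card V" arbitrary: V f T rule: less_induct)
  case less
  have "V \<noteq> {}" using less.prems by (auto simp: con_def)
  then have pos: "card V > 0" using less.prems by auto
  show ?case
  proof (cases "card V = 1")
    case True
    then show ?thesis using con_card_1[OF less.prems(3)] by (auto intro!: exI[of _ "{}"])
  next
    case False
    then have "\<not> is_singleton V" by (simp add: is_singleton_altdef)
    then obtain u w where uw: "u \<in> V" "w \<in> V" "u \<noteq> w" using \<open>V \<noteq> {}\<close>
      unfolding is_singleton_def by blast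
    obtain e v where e: "e \<in> T" "f e = {#u, v#}" "u \<noteq> v"
      using con_nonloop_edge[OF less.prems(3) uw] less.prems(4) by metis
    have v: "v \<in> V" using less.prems(4)[OF e(1)] e by auto
    let ?g = "\<lambda>x. image_mset (id(v := u)) (f x)"
    have Te: "insert e (T - {e}) = T" using e by auto
    have c: "con (V - {v}) ?g (T - {e})"
      using con_contract[of f e u v V "T - {e}"] e less.prems(3) uw Te by simp
    have cV: "card (V - {v}) + 1 = card V" using v less.prems(1) pos by simp
    have cT: "card (T - {e}) + 1 = card T" using e less.prems(2) by (metis Suc_eq_plus1 card_Suc_Diff1)
    have sub: "size (?g d) = 2 \<and> set_mset (?g d) \<subseteq> V - {v}" if "d \<in> T - {e}" for d
      using less.prems(4)[of d] that uw e by auto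
    have IH: "card (V - {v}) \<le> card (T - {e}) + 1 \<and>
      (\<exists>S\<subseteq>T - {e}. con (V - {v}) ?g S \<and> card S + 1 = card (V - {v}))"
      by (rule less.hyps) (use cV less.prems c sub in auto)
    then obtain S where S: "S \<subseteq> T - {e}" "con (V - {v}) ?g S" "card S + 1 = card (V - {v})" by blast
    have "con V f (insert e S)" using con_contract[of f e u v V S] e uw S by simp
    moreover have "card (insert e S) = card S + 1"
      using S(1) less.prems(2) by (subst card_insert_disjoint) (auto intro: finite_subset)
    moreover have "insert e S \<subseteq> T" using S e by auto
    ultimately show ?thesis using IH S cV cT by (metis add_le_cancel_right)
  qed
qed

lemma con_card_le:
  assumes "finite V" "finite T" "con V f T" "\<And>e. e \<in> T \<Longrightarrow> size (f e) = 2 \<and> set_mset (f e) \<subseteq> V"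
  shows "card V \<le> card T + 1"
  using con_spanning_tree_aux[OF assms] by blast

lemma con_imp_tree:
  assumes "finite V" "finite T" "con V f T" "\<And>e. e \<in> T \<Longrightarrow> size (f e) = 2 \<and> set_mset (f e) \<subseteq> V"
  obtains S where "S \<in> trees V f T"
  using con_spanning_tree_aux[OF assms] unfolding trees_def by blast

lemma finite_trees: "finite E \<Longrightarrow> finite (trees V f E)"
  unfolding trees_def by simp

text \<open>Deletion-contraction. Trees without \<open>e\<close> are trees of the deletion; removing
  \<open>e\<close> from the others is a bijection onto the trees of the contraction, where
  \<open>v\<close> is absorbed into \<open>u\<close>.\<close>

lemma card_trees_insert:
  assumes fin: "finite E" "finite V" and e: "f e = {#u, v#}" "e \<notin> E" and uv: "u \<in> V" "v \<in> V" "u \<noteq> v"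
  shows "card (trees V f (insert e E)) =
    card (trees V f E) + card (trees (V - {v}) (\<lambda>x. image_mset (id(v := u)) (f x)) E)"
proof -
  let ?C = "trees (V - {v}) (\<lambda>x. image_mset (id(v := u)) (f x)) E"
  have cV: "card V = card (V - {v}) + 1" using uv fin by (metis Suc_eq_plus1 card_Suc_Diff1)
  have ci: "card (insert e S) = card S + 1" if "S \<subseteq> E" for S
    using that e fin by (subst card_insert_disjoint) (auto intro: finite_subset)
  have "trees V f (insert e E) = trees V f E \<union> insert e ` ?C"
  proof (rule set_eqI)
    fix T
    show "T \<in> trees V f (insert e E) \<longleftrightarrow> T \<in> trees V f E \<union> insert e ` ?C"
    proof (cases "e \<in> T")
      case False then show ?thesis unfolding trees_def by auto
    next
      case True
      then obtain S where S: "T = insert e S" "e \<notin> S" by (meson mk_disjoint_insert)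
      have "T \<in> trees V f (insert e E) \<longleftrightarrow> S \<in> ?C"
      proof -
        have "T \<in> trees V f (insert e E) \<longleftrightarrow>
            S \<subseteq> E \<and> con V f (insert e S) \<and> card (insert e S) + 1 = card V"
          using S e by (auto simp: trees_def)
        moreover have "S \<subseteq> E \<Longrightarrow> card (insert e S) + 1 = card V \<longleftrightarrow> card S + 1 = card (V - {v})"
          unfolding cV using ci[of S] by presburger
        ultimately show ?thesis
          unfolding trees_def con_contract[of f e u v V S, OF e(1) uv(1,3)] by blast
      qed
      moreover have "T \<in> insert e ` ?C \<longleftrightarrow> S \<in> ?C"
      proof
        assume "T \<in> insert e ` ?C"
        then obtain S' where "S' \<in> ?C" "T = insert e S'" by auto
        moreover then have "e \<notin> S'" using e by (auto simp: trees_def)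
        ultimately show "S \<in> ?C" using S by (metis insert_ident)
      qed (use S in auto)
      moreover have "T \<notin> trees V f E" using True e by (auto simp: trees_def)
      ultimately show ?thesis by auto
    qed
  qed
  moreover have "trees V f E \<inter> insert e ` ?C = {}" using e by (auto simp: trees_def)
  moreover have "card (insert e ` ?C) = card ?C"
  proof (rule card_image, rule inj_onI)
    fix S S' assume "S \<in> ?C" "S' \<in> ?C" "insert e S = insert e S'"
    moreover then have "e \<notin> S" "e \<notin> S'" using e by (auto simp: trees_def)
    ultimately show "S = S'" by (metis insert_ident)
  qed
  ultimately show ?thesis using fin by (simp add: card_Un_disjoint finite_trees)
qed

section \<open>Trees and cycles\<close>

definition is_path :: "('e \<Rightarrow> 'v multiset) \<Rightarrow> 'e set \<Rightarrow> 'v list \<Rightarrow> 'e list \<Rightarrow> bool" where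
  "is_path f T vs es \<longleftrightarrow> length vs = Suc (length es) \<and> distinct vs \<and> set es \<subseteq> T \<and>
     (\<forall>i<length es. f (es ! i) = {#vs ! i, vs ! Suc i#})"

text \<open>Equal edges at positions i < j would have the same ends, so the i-th vertex would occur
  again later.\<close>

lemma is_path_distinct_edges:
  assumes "is_path f T vs es" shows "distinct es"
proof -
  have "es ! i \<noteq> es ! j" if "i < j" "j < length es" for i j
  proof
    assume "es ! i = es ! j"
    then have "{#vs ! i, vs ! Suc i#} = {#vs ! j, vs ! Suc j#}"
      using assms that unfolding is_path_def by (metis less_trans)
    then have "vs ! i = vs ! j \<or> vs ! i = vs ! Suc j" by (auto simp: add_eq_conv_ex)
    then show False using assms that by (auto simp: is_path_def nth_eq_iff_index_eq)
  qed
  then show ?thesis by (auto simp: distinct_conv_nth) (metis nat_neq_iff)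
qed

text \<open>If \<open>z\<close> was already visited, the path is cut off at \<open>z\<close> instead
  of being prolonged; this keeps the vertices distinct.\<close>

lemma is_path_extend:
  assumes p: "is_path f T vs es" and e: "e \<in> T" "f e = {#last vs, z#}"
  shows "\<exists>vs' es'. is_path f T vs' es' \<and> hd vs' = hd vs \<and> last vs' = z"
proof (cases "z \<in> set vs")
  case True
  then obtain i where i: "i < length vs" "vs ! i = z" by (auto simp: in_set_conv_nth)
  have "is_path f T (take (Suc i) vs) (take i es)"
    using p i set_take_subset[of i es] unfolding is_path_def by auto
  moreover have "last (take (Suc i) vs) = z" using i by (simp add: take_Suc_conv_app_nth)
  moreover have "hd (take (Suc i) vs) = hd vs" by simp
  ultimately show ?thesis by blast
next
  case False
  have ne: "vs \<noteq> []" using p by (auto simp: is_path_def)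
  have "is_path f T (vs @ [z]) (es @ [e])"
    using p e False ne unfolding is_path_def
    by (auto simp: nth_append less_Suc_eq last_conv_nth)
  then show ?thesis using ne by (intro exI[of _ "vs @ [z]"] exI[of _ "es @ [e]"]) auto
qed

text \<open>Being the end of a path from \<open>a\<close> is a colouring that is constant on edges,
  so connectivity by cuts yields paths.\<close>

lemma con_imp_path:
  assumes c: "con V f T" and ab: "a \<in> V" "b \<in> V"
    and sz: "\<And>e. e \<in> T \<Longrightarrow> size (f e) = 2"
  obtains vs es where "is_path f T vs es" "hd vs = a" "last vs = b"
proof -
  let ?P = "\<lambda>z. \<exists>vs es. is_path f T vs es \<and> hd vs = a \<and> last vs = z"
  have step: "?P y" if "?P x" "e \<in> T" "f e = {#x, y#}" for x y e
    using that is_path_extend[of f T _ _ e y] by metis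
  have "edge_const f T ?P"
    unfolding edge_const_def
  proof (intro ballI)
    fix e x y assume e: "e \<in> T" and xy: "x \<in># f e" "y \<in># f e"
    obtain p q where pq: "f e = {#p, q#}"
      using size_mset_2[OF sz[OF e]] .
    then have "f e = {#q, p#}" by (simp add: add_mset_commute)
    then show "?P x = ?P y" using step[OF _ e pq] step[OF _ e, of q p] xy pq by auto
  qed
  moreover have "?P a" by (rule exI[of _ "[a]"], rule exI[of _ "[]"]) (auto simp: is_path_def)
  ultimately have "?P b" using conD[OF c, of ?P a b] ab by blast
  then show thesis using that by blast
qed

section \<open>Agreement with connectedness by walks and trees by cycles\<close>

context weighted_multigraph
begin

lemma obtain_ends:
  assumes "e \<in> edges G" obtains a b where "ends G e = {#a, b#}" "a \<in> verts G" "b \<in> verts G"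
proof -
  obtain a b where "ends G e = {#a, b#}"
    using size_mset_2[OF size_ends[OF assms]] .
  then show thesis using that ends_in_verts[OF assms] by auto
qed

lemma obtain_ends_at:
  assumes "e \<in> edges G" "v \<in># ends G e" obtains b where "ends G e = {#v, b#}" "v \<in> verts G" "b \<in> verts G"
proof -
  obtain a b where ab: "ends G e = {#a, b#}" "a \<in> verts G" "b \<in> verts G" using obtain_ends[OF assms(1)] .
  then show thesis using that[of a] that[of b] assms(2) by (auto simp: add_mset_commute)
qed

lemma weighted_multigraph_subset: "T \<subseteq> edges G \<Longrightarrow> weighted_multigraph (G\<lparr>edges := T\<rparr>)"
  using finite_verts finite_edges size_ends ends_in_verts
  by unfold_locales (auto intro: finite_subset)

text \<open>A colouring constant on edges is constant along walks; conversely, reachability from a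
  fixed vertex is such a colouring.\<close>

lemma graph_connected_iff: "graph_connected G \<longleftrightarrow> con (verts G) (ends G) (edges G)"
proof -
  have sym: "sym (adj G)" unfolding adj_def sym_def by (auto simp: add_mset_commute)
  have sub: "x \<in> verts G \<and> y \<in> verts G" if "(x, y) \<in> adj G" for x y
    using that ends_in_verts by (fastforce simp: adj_def)
  have eq: "equiv (verts G) (reachable G)"
  proof (rule equivI)
    show "refl_on (verts G) (reachable G)" by (auto simp: refl_on_def reachable_def)
    show "sym (reachable G)" using sym_rtrancl[OF sym] by (auto simp: sym_def reachable_def)
    show "trans (reachable G)" by (auto simp: trans_def reachable_def)
  qed (auto simp: reachable_def)
  have "graph_connected G \<longleftrightarrow> verts G \<noteq> {} \<and> (\<forall>x\<in>verts G. \<forall>y\<in>verts G. (x, y) \<in> (adj G)\<^sup>*)"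
  proof
    assume "graph_connected G"
    then obtain C where C: "verts G // reachable G = {C}"
      by (auto simp: graph_connected_def components_def card_1_singleton_iff)
    have "verts G \<noteq> {}" using C by (auto simp: quotient_def)
    moreover have "(x, y) \<in> (adj G)\<^sup>*" if "x \<in> verts G" "y \<in> verts G" for x y
    proof -
      have "reachable G `` {x} = C" "reachable G `` {y} = C" using C that quotientI by (metis singletonD)+
      then have "(x, y) \<in> reachable G" using eq_equiv_class[OF _ eq] that by metis
      then show ?thesis by (simp add: reachable_def)
    qed
    ultimately show "verts G \<noteq> {} \<and> (\<forall>x\<in>verts G. \<forall>y\<in>verts G. (x, y) \<in> (adj G)\<^sup>*)" by blast
  next
    assume a: "verts G \<noteq> {} \<and> (\<forall>x\<in>verts G. \<forall>y\<in>verts G. (x, y) \<in> (adj G)\<^sup>*)"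
    then have "reachable G = verts G \<times> verts G" by (auto simp: reachable_def)
    then have "verts G // reachable G = {verts G}" using a by (auto simp: quotient_def)
    then show "graph_connected G" by (auto simp: graph_connected_def components_def)
  qed
  also have "\<dots> \<longleftrightarrow> con (verts G) (ends G) (edges G)"
  proof
    assume a: "verts G \<noteq> {} \<and> (\<forall>x\<in>verts G. \<forall>y\<in>verts G. (x, y) \<in> (adj G)\<^sup>*)"
    have "P x = P y" if "edge_const (ends G) (edges G) P" "(x, y) \<in> (adj G)\<^sup>*" for P x y
      using that(2,1) by (induction) (auto simp: adj_def dest: edge_const_edge)
    then show "con (verts G) (ends G) (edges G)" using a unfolding con_def by blast
  next
    assume c: "con (verts G) (ends G) (edges G)"
    have "(x, y) \<in> (adj G)\<^sup>*" if x: "x \<in> verts G" "y \<in> verts G" for x y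
    proof -
      have "edge_const (ends G) (edges G) (\<lambda>z. (x, z) \<in> (adj G)\<^sup>*)"
        unfolding edge_const_def
      proof (intro ballI)
        fix e a b assume e: "e \<in> edges G" "a \<in># ends G e" "b \<in># ends G e"
        obtain p q where pq: "ends G e = {#p, q#}" using obtain_ends[OF e(1)] by metis
        then have "(p, q) \<in> adj G" "(q, p) \<in> adj G" using e sym by (auto simp: adj_def sym_def)
        then show "((x, a) \<in> (adj G)\<^sup>*) = ((x, b) \<in> (adj G)\<^sup>*)"
          using e pq by (auto intro: rtrancl_into_rtrancl)
      qed
      from conD[OF c this x] show ?thesis by simp
    qed
    then show "verts G \<noteq> {} \<and> (\<forall>x\<in>verts G. \<forall>y\<in>verts G. (x, y) \<in> (adj G)\<^sup>*)"
      using c unfolding con_def by (intro conjI ballI) simp_all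
  qed
  finally show ?thesis .
qed

lemma is_tree_iff:
  "is_tree G \<longleftrightarrow> con (verts G) (ends G) (edges G) \<and> card (edges G) + 1 = card (verts G)"
proof (cases "con (verts G) (ends G) (edges G)")
  case False then show ?thesis by (simp add: is_tree_def graph_connected_iff)
next
  case True
  have sz: "e \<in> edges G \<Longrightarrow> size (ends G e) = 2 \<and> set_mset (ends G e) \<subseteq> verts G" for e
    using size_ends ends_in_verts by auto
  have "(\<exists>vs es. is_cycle G vs es) \<longleftrightarrow> card (edges G) + 1 \<noteq> card (verts G)"
  proof
    assume "\<exists>vs es. is_cycle G vs es"
    then obtain vs es where cyc: "is_cycle G vs es" by blast
    \<comment> \<open>The last edge is the one dropped: for all others the successor index does not
      wrap around.\<close>
    let ?n = "length es - 1"
    let ?e = "es ! ?n"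
    have n: "length es = Suc ?n" "length vs = Suc ?n" using cyc by (auto simp: is_cycle_def)
    have e: "?e \<in> edges G" "ends G ?e = {#vs ! ?n, vs ! 0#}"
      using cyc n unfolding is_cycle_def by (metis lessI nth_mem subsetD, metis lessI mod_self)
    have ed: "es ! i \<in> edges G - {?e}" "ends G (es ! i) = {#vs ! i, vs ! Suc i#}" if "i < ?n" for i
    proof -
      have "Suc i mod length vs = Suc i" using that n by simp
      then show "ends G (es ! i) = {#vs ! i, vs ! Suc i#}" using cyc that n unfolding is_cycle_def
        by (metis less_SucI)
      show "es ! i \<in> edges G - {?e}" using cyc that n unfolding is_cycle_def
        by (auto simp: nth_eq_iff_index_eq)
    qed
    have "edge_const (ends G) (edges G) P" if P: "edge_const (ends G) (edges G - {?e}) P" for P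
    proof -
      have "P (vs ! i) = P (vs ! 0)" if "i \<le> ?n" for i
        using that
      proof (induction i)
        case (Suc i)
        then have "i < ?n" by simp
        from edge_const_edge[OF P ed[OF this]] Suc show ?case by (metis Suc_leD)
      qed simp
      then have "P (vs ! ?n) = P (vs ! 0)" by blast
      then have "edge_const (ends G) (insert ?e (edges G - {?e})) P"
        using P edge_const_insert[of "ends G", OF e(2)] by blast
      then show ?thesis using e(1) by (simp only: insert_Diff)
    qed
    then have "con (verts G) (ends G) (edges G - {?e})" by (rule con_weaken[OF True])
    then have "card (verts G) \<le> card (edges G - {?e}) + 1"
      by (rule con_card_le[rotated 2]) (use sz finite_verts finite_edges in auto)
    moreover have "card (edges G - {?e}) + 1 = card (edges G)"
      using e finite_edges by (metis Suc_eq_plus1 card_Suc_Diff1)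
    ultimately show "card (edges G) + 1 \<noteq> card (verts G)" by simp
  next
    assume ne: "card (edges G) + 1 \<noteq> card (verts G)"
    obtain S where S: "S \<in> trees (verts G) (ends G) (edges G)"
      by (rule con_imp_tree[OF finite_verts finite_edges True]) (use sz in auto)
    then have "S \<noteq> edges G" using ne by (auto simp: trees_def)
    then obtain e where e: "e \<in> edges G" "e \<notin> S" using S by (auto simp: trees_def)
    \<comment> \<open>The ends are named so that \<open>e\<close> leads from the last vertex
      \<open>b\<close> of the path back to the first vertex \<open>a\<close>. A loop is covered by
      the path without edges.\<close>
    obtain a b where ab: "ends G e = {#b, a#}" "a \<in> verts G" "b \<in> verts G"
      using obtain_ends[OF e(1)] by metis
    obtain vs es where p: "is_path (ends G) S vs es" "hd vs = a" "last vs = b"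
      by (rule con_imp_path[of "verts G" "ends G" S a b]) (use S sz ab in \<open>auto simp: trees_def\<close>)
    have vs: "vs ! 0 = a" "vs ! length es = b" "length vs = Suc (length es)"
      using p by (auto simp: is_path_def hd_conv_nth last_conv_nth simp flip: length_0_conv)
    \<comment> \<open>\<open>is_path\<close> puts no vertex into V by itself: the last vertex is
      \<open>b\<close>, every other one is an end of an edge of the path.\<close>
    have inV: "x \<in> verts G" if "x \<in> set vs" for x
    proof -
      obtain i where i: "i < length vs" "x = vs ! i" using \<open>x \<in> set vs\<close> by (auto simp: in_set_conv_nth)
      show ?thesis
      proof (cases "i = length es")
        case True then show ?thesis using i vs ab by simp
      next
        case False
        then have "i < length es" using i vs by simp
        then have "ends G (es ! i) = {#vs ! i, vs ! Suc i#}" "es ! i \<in> edges G"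
          using p(1) S unfolding is_path_def trees_def by (auto dest: nth_mem)
        then show ?thesis using ends_in_verts i by fastforce
      qed
    qed
    have "is_cycle G vs (es @ [e])"
      unfolding is_cycle_def
    proof (intro conjI allI impI)
      show "distinct (es @ [e])" using is_path_distinct_edges[OF p(1)] p(1) e by (auto simp: is_path_def)
      show "set (es @ [e]) \<subseteq> edges G" using p(1) e S by (auto simp: is_path_def trees_def)
      fix i assume i: "i < length (es @ [e])"
      show "ends G ((es @ [e]) ! i) = {#vs ! i, vs ! (Suc i mod length vs)#}"
      proof (cases "i = length es")
        case True then show ?thesis using vs ab by simp
      next
        case False then show ?thesis using i p(1) vs by (simp add: is_path_def nth_append)
      qed
    qed (use p inV in \<open>auto simp: is_path_def\<close>)
    then show "\<exists>vs es. is_cycle G vs es" by blast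
  qed
  then show ?thesis using True by (auto simp: is_tree_def graph_connected_iff)
qed

lemma complexity_eq: "complexity G = card (trees (verts G) (ends G) (edges G))"
proof -
  have "T \<subseteq> edges G \<Longrightarrow> is_tree (G\<lparr>edges := T\<rparr>) \<longleftrightarrow> con (verts G) (ends G) T \<and> card T + 1 = card (verts G)"
    for T using weighted_multigraph.is_tree_iff[OF weighted_multigraph_subset] by auto
  then have "spanning_trees G = trees (verts G) (ends G) (edges G)"
    unfolding spanning_trees_def trees_def by auto
  then show ?thesis by (simp add: complexity_def)
qed

end

section \<open>Splitting, loops and contraction\<close>

text \<open>The number of components is replaced by 1 in the genus. Excess at least 1 reads
  \<open>3 \<le> 2 * weight G v + degree G v\<close> without subtraction; later
  \<open>4 \<le>\<close> expresses excess at least 2.\<close>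

definition stable_con :: "int \<Rightarrow> ('v, 'e) wmgraph \<Rightarrow> bool" where
  "stable_con g G \<longleftrightarrow> weighted_multigraph G \<and> con (verts G) (ends G) (edges G) \<and>
     int (\<Sum>v\<in>verts G. weight G v) + int (card (edges G)) - int (card (verts G)) + 1 = g \<and>
     (\<forall>v\<in>verts G. 3 \<le> 2 * weight G v + degree G v)"

lemma stable_con_iff: "stable_con g G \<longleftrightarrow> G \<in> stable_graphs g \<and> graph_connected G"
proof (cases "weighted_multigraph G")
  case True
  then have "graph_connected G \<longleftrightarrow> con (verts G) (ends G) (edges G)"
    by (rule weighted_multigraph.graph_connected_iff)
  moreover have "graph_connected G \<Longrightarrow> card (components G) = 1" by (simp add: graph_connected_def)
  ultimately show ?thesis using True
    by (auto simp: stable_con_def stable_graphs_def genus_def betti_def; force)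
qed (auto simp: stable_con_def stable_graphs_def)

lemma stable_con_wm: "stable_con g G \<Longrightarrow> weighted_multigraph G"
  by (simp add: stable_con_def)

lemma stable_con_con: "stable_con g G \<Longrightarrow> con (verts G) (ends G) (edges G)"
  by (simp add: stable_con_def)

lemma stable_con_transfer:
  assumes "stable_con g G" "weighted_multigraph G'" "con (verts G') (ends G') (edges G')"
    and "(\<Sum>v\<in>verts G'. weight G' v) + card (edges G') + card (verts G) =
      (\<Sum>v\<in>verts G. weight G v) + card (edges G) + card (verts G')"
    and "\<And>v. v \<in> verts G' \<Longrightarrow> 3 \<le> 2 * weight G' v + degree G' v"
  shows "stable_con g G'"
  using assms unfolding stable_con_def by (intro conjI ballI) (blast | linarith)+

text \<open>Each edge in \<open>M\<close> has one end moved from \<open>v\<close> to the new vertex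
  \<open>n\<close>. Of a loop at \<open>v\<close> only one end moves, so it becomes an edge between
  \<open>v\<close> and \<open>n\<close>.\<close>

definition split_ends :: "('e \<Rightarrow> 'v multiset) \<Rightarrow> 'v \<Rightarrow> 'v \<Rightarrow> 'e set \<Rightarrow> 'e \<Rightarrow> 'v multiset" where
  "split_ends f v n M e = (if e \<in> M then add_mset n (f e - {#v#}) else f e)"

text \<open>Colourings with equal values at \<open>n\<close> and \<open>v\<close> descend to the
  unsplit graph. To keep a split connected it is therefore enough to force
  \<open>P n = P v\<close>.\<close>

lemma split_edge_const:
  assumes P: "edge_const (split_ends f v n M) E P" "P n = P v"
    and M: "\<And>e. e \<in> M \<Longrightarrow> \<exists>b. f e = {#v, b#}"
  shows "edge_const f E P"
  unfolding edge_const_def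
proof (intro ballI)
  fix e x y assume e: "e \<in> E" and xy: "x \<in># f e" "y \<in># f e"
  show "P x = P y"
  proof (cases "e \<in> M")
    case True
    then obtain b where b: "f e = {#v, b#}" using M by blast
    have "P n = P b" using edge_const_edge[OF P(1) e, of n b] True b by (simp add: split_ends_def)
    then show ?thesis using xy b P(2) by auto
  next
    case False
    then have "split_ends f v n M e = f e" by (simp add: split_ends_def)
    then show ?thesis using P(1) e xy unfolding edge_const_def by metis
  qed
qed

lemma con_split:
  assumes c: "con V f E" and v: "v \<in> V"
    and M: "\<And>e. e \<in> M \<Longrightarrow> \<exists>b. f e = {#v, b#}"
    and P: "\<And>P. edge_const (split_ends f v n M) E P \<Longrightarrow> P n = P v"
  shows "con (insert n V) (split_ends f v n M) E"
proof (rule conI[of v])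
  fix P x assume p: "edge_const (split_ends f v n M) E P" and x: "x \<in> insert n V"
  have "edge_const f E P" using split_edge_const[OF p P[OF p] M] .
  then show "P x = P v" using conD[OF c, of P x v] P[OF p] x v by auto
qed (use v in auto)

text \<open>The split loop itself joins \<open>v\<close> to \<open>n\<close>.\<close>

lemma con_split_loop:
  assumes c: "con V f E" and v: "v \<in> V" and l: "l \<in> E" "f l = {#v, v#}" and e: "f e = {#v, b#}"
  shows "con (insert n V) (split_ends f v n {l, e}) E"
proof (rule con_split[OF c v])
  fix P assume "edge_const (split_ends f v n {l, e}) E P"
  from edge_const_edge[OF this l(1), of n v] show "P n = P v" using l by (simp add: split_ends_def)
qed (use l e in auto)

text \<open>If \<open>P\<close> and \<open>Q\<close> separate \<open>v\<close> from \<open>n\<close> after the two splittings, then their join separates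
  \<open>v\<close> from \<open>z\<close> in the graph without \<open>e\<close>.\<close>

lemma con_split_nonbridge:
  assumes c: "con V f (E - {e})" and v: "v \<in> V" and z: "z \<in> V"
    and e: "e \<in> E" "f e = {#v, z#}" and h: "h \<in> E" "f h = {#v, a#}" and h': "h' \<in> E" "f h' = {#v, b#}"
    and ne: "e \<noteq> h" "e \<noteq> h'" "h \<noteq> h'"
  shows "con (insert n V) (split_ends f v n {e, h}) E \<or> con (insert n V) (split_ends f v n {e, h'}) E"
proof (rule ccontr)
  assume no: "\<not> ?thesis"
  have c': "con V f E" by (rule con_mono[OF c]) auto
  have M: "\<exists>b. f x = {#v, b#}" if "x \<in> {e, h, h'}" for x using that e h h' by auto
  obtain P where P: "edge_const (split_ends f v n {e, h}) E P" "P n \<noteq> P v"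
    using con_split[OF c' v, of "{e, h}" n] no M by blast
  obtain Q where Q: "edge_const (split_ends f v n {e, h'}) E Q" "Q n \<noteq> Q v"
    using con_split[OF c' v, of "{e, h'}" n] no M by blast
  have Pz: "P n = P z" using edge_const_edge[OF P(1) e(1), of n z] e by (simp add: split_ends_def)
  have Qz: "Q n = Q z" using edge_const_edge[OF Q(1) e(1), of n z] e by (simp add: split_ends_def)
  have Pb: "P v = P b" using edge_const_edge[OF P(1) h'(1), of v b] h' ne by (simp add: split_ends_def)
  have Qa: "Q v = Q a" using edge_const_edge[OF Q(1) h(1), of v a] h ne by (simp add: split_ends_def)
  \<comment> \<open>\<open>h\<close> stays at \<open>v\<close> in the second split, so
    \<open>Q\<close> puts \<open>a\<close> on the side of \<open>v\<close>; \<open>h'\<close> stays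
    there in the first, so \<open>P\<close> does the same with \<open>b\<close>. Hence both edges
    respect the join.\<close>
  let ?R = "\<lambda>x. P x = P v \<or> Q x = Q v"
  have "edge_const f (E - {e}) ?R"
    unfolding edge_const_def
  proof (intro ballI)
    fix d x y assume d: "d \<in> E - {e}" and xy: "x \<in># f d" "y \<in># f d"
    consider "d = h" | "d = h'" | "d \<noteq> h" "d \<noteq> h'" by blast
    then show "?R x = ?R y"
    proof cases
      case 3
      then have "split_ends f v n {e, h} d = f d" "split_ends f v n {e, h'} d = f d"
        using d by (auto simp: split_ends_def)
      then have "P x = P y" "Q x = Q y"
        using P(1) Q(1) d xy unfolding edge_const_def by (metis DiffD1)+
      then show ?thesis by simp
    qed (use xy h h' Pb Qa in auto)
  qed
  from conD[OF c this v z] show False using Pz Qz P(2) Q(2) by auto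
qed

text \<open>The new edge \<open>k\<close> joins \<open>v\<close> and \<open>n\<close>. Contracting
  it gives back the old graph, so the trees through \<open>k\<close> already number
  \<open>complexity G\<close>; assumption \<open>c\<close> provides one more tree, which avoids
  \<open>k\<close>. The vertex \<open>n\<close> gets degree 3 and \<open>v\<close> loses one unit of
  excess, hence the bound 4.\<close>

lemma split_improves:
  assumes st: "stable_con g G" and v: "v \<in> verts G" and ex: "4 \<le> 2 * weight G v + degree G v"
    and e: "e1 \<in> edges G" "e2 \<in> edges G" "e1 \<noteq> e2" "v \<in># ends G e1" "v \<in># ends G e2"
    and n: "n \<notin> verts G" and k: "k \<notin> edges G"
    and c: "con (insert n (verts G)) (split_ends (ends G) v n {e1, e2}) (edges G)"
  shows "\<exists>G' :: ('v, 'e) wmgraph. stable_con g G' \<and> complexity (G :: ('v, 'e) wmgraph) < complexity G'"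
proof -
  interpret weighted_multigraph G by (rule stable_con_wm[OF st])
  let ?s = "split_ends (ends G) v n {e1, e2}"
  let ?f = "?s(k := {#v, n#})"
  let ?V = "insert n (verts G)" and ?E = "insert k (edges G)"
  define G' where "G' = \<lparr>verts = ?V, edges = ?E, ends = ?f, weight = (weight G)(n := 0)\<rparr>"
  note [simp] = finite_verts finite_edges
  have vn: "v \<noteq> n" using v n by auto
  obtain b1 where b1: "ends G e1 = {#v, b1#}" "b1 \<in> verts G" using obtain_ends_at[OF e(1,4)] by metis
  obtain b2 where b2: "ends G e2 = {#v, b2#}" "b2 \<in> verts G" using obtain_ends_at[OF e(2,5)] by metis
  have bn: "b1 \<noteq> n" "b2 \<noteq> n" using b1 b2 n by auto
  have fk: "?f x = ?s x" if "x \<in> edges G" for x using that k by auto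
  have out: "?s x = ends G x" if "x \<noteq> e1" "x \<noteq> e2" for x using that by (simp add: split_ends_def)
  have in1: "?s e1 = {#n, b1#}" and in2: "?s e2 = {#n, b2#}"
    using b1 b2 by (auto simp: split_ends_def)
  have sz: "size (?s x) = 2 \<and> set_mset (?s x) \<subseteq> ?V" if "x \<in> edges G" for x
    using size_ends[OF that] ends_in_verts[OF that] in1 in2 b1 b2 out[of x]
    by (cases "x = e1"; cases "x = e2") auto
  have wm: "weighted_multigraph G'"
  proof
    fix x assume "x \<in> edges G'"
    then have "x = k \<or> x \<in> edges G \<and> x \<noteq> k" using k by (auto simp: G'_def)
    then show "size (ends G' x) = 2" "set_mset (ends G' x) \<subseteq> verts G'"
      using sz[of x] v by (auto simp: G'_def)
  qed (auto simp: G'_def)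
  have conk: "con ?V ?f (edges G)" using c con_cong[of "edges G" ?f ?s] fk by simp
  then have con': "con ?V ?f ?E" by (rule con_mono) auto
  define R where "R = edges G - {e1, e2}"
  have E: "edges G = insert e1 (insert e2 R)" "e1 \<notin> insert e2 R" "e2 \<notin> R" "finite R"
    using e by (auto simp: R_def)
  have nR: "count (ends G x) n = 0" if "x \<in> edges G" for x
    using ends_in_verts[OF that] n by (auto simp: count_eq_zero_iff)
  have deg: "degree G' z = count {#v, n#} z + (count (?s e1) z + (count (?s e2) z + (\<Sum>x\<in>R. count (ends G x) z)))" for z
  proof -
    have "degree G' z = count {#v, n#} z + (\<Sum>x\<in>edges G. count (?s x) z)"
      using k unfolding degree_def G'_def
      by (simp, intro sum.cong) (auto simp: fk)
    also have "(\<Sum>x\<in>edges G. count (?s x) z) =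
        count (?s e1) z + (count (?s e2) z + (\<Sum>x\<in>R. count (?s x) z))"
      using E by simp
    also have "(\<Sum>x\<in>R. count (?s x) z) = (\<Sum>x\<in>R. count (ends G x) z)"
      by (rule sum.cong) (auto simp: out R_def)
    finally show ?thesis .
  qed
  have degG: "degree G z = count (ends G e1) z + (count (ends G e2) z + (\<Sum>x\<in>R. count (ends G x) z))" for z
    using E by (simp add: degree_def)
  have "3 \<le> 2 * weight G' z + degree G' z" if z: "z \<in> verts G'" for z
  proof -
    consider "z = n" | "z = v" | "z \<noteq> n" "z \<noteq> v" "z \<in> verts G" using z by (auto simp: G'_def)
    then show ?thesis
    proof cases
      case 1
      then show ?thesis unfolding deg in1 in2 using vn bn by simp
    next
      case 2
      have "degree G' v + 1 = degree G v"
        unfolding deg degG in1 in2 b1(1) b2(1) using vn bn by auto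
      then show ?thesis using 2 ex vn by (simp add: G'_def)
    next
      case 3
      have "degree G' z = degree G z"
        unfolding deg degG in1 in2 b1(1) b2(1) using 3 bn by auto
      then show ?thesis using 3 st by (auto simp: G'_def stable_con_def)
    qed
  qed
  moreover have "(\<Sum>x\<in>verts G'. weight G' x) = (\<Sum>x\<in>verts G. weight G x)"
    using n by (simp add: G'_def) (rule sum.cong, auto)
  ultimately have "stable_con g G'"
    using stable_con_transfer[OF st wm] con' n k by (simp add: G'_def)
  moreover have "complexity G < complexity G'"
  proof -
    let ?C = "trees (?V - {n}) (\<lambda>x. image_mset (id(n := v)) (?f x)) (edges G)"
    \<comment> \<open>Sending \<open>n\<close> back to \<open>v\<close> undoes the split.\<close>
    have im: "image_mset (id(n := v)) (?f x) = ends G x" if x: "x \<in> edges G" for x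
    proof -
      obtain a b where ab: "ends G x = {#a, b#}" "a \<in> verts G" "b \<in> verts G" using obtain_ends[OF x] .
      show ?thesis
      proof (cases "x = e1 \<or> x = e2")
        case True then show ?thesis using fk[OF x] in1 in2 b1 b2 bn by auto
      next
        case False
        then have "?f x = {#a, b#}" using fk[OF x] out[of x] ab by simp
        moreover have "a \<noteq> n" "b \<noteq> n" using ab n by auto
        ultimately show ?thesis using ab by simp
      qed
    qed
    have "card (trees ?V ?f ?E) = card (trees ?V ?f (edges G)) + card ?C"
      by (rule card_trees_insert) (use v n k vn in auto)
    moreover have "?C = trees (verts G) (ends G) (edges G)"
    proof -
      have V: "?V - {n} = verts G" using n by simp
      show ?thesis unfolding V by (rule trees_cong[OF im])
    qed
    moreover have "card (trees ?V ?f (edges G)) > 0"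
    proof -
      obtain S where "S \<in> trees ?V ?f (edges G)"
        by (rule con_imp_tree[of ?V "edges G" ?f]) (use conk sz fk in auto)
      then show ?thesis using finite_trees[OF finite_edges] by (auto simp: card_gt_0_iff)
    qed
    ultimately show ?thesis
      using complexity_eq weighted_multigraph.complexity_eq[OF wm] by (simp add: G'_def)
  qed
  ultimately show ?thesis by blast
qed

section \<open>Trading weight for loops; contracting bridges\<close>

lemma add_loop:
  fixes G :: "('v, 'e) wmgraph"
  assumes st: "stable_con g G" and v: "v \<in> verts G" and w: "0 < weight G v" and l: "l \<notin> edges G"
  defines "G' \<equiv> \<lparr>verts = verts G, edges = insert l (edges G), ends = (ends G)(l := {#v, v#}),
    weight = (weight G)(v := weight G v - 1)\<rparr>"
  shows "stable_con g G'" "complexity G \<le> complexity G'" "degree G' v = degree G v + 2"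
proof -
  interpret weighted_multigraph G by (rule stable_con_wm[OF st])
  note [simp] = finite_verts finite_edges
  have wm: "weighted_multigraph G'"
    using size_ends ends_in_verts v by unfold_locales (auto simp: G'_def split: if_splits)
  have eq: "((ends G)(l := {#v, v#})) x = ends G x" if "x \<in> edges G" for x using that l by auto
  have "con (verts G) ((ends G)(l := {#v, v#})) (edges G) = con (verts G) (ends G) (edges G)"
    by (rule con_cong[OF eq])
  then have "con (verts G) ((ends G)(l := {#v, v#})) (edges G)"
    using stable_con_con[OF st] by simp
  then have c: "con (verts G') (ends G') (edges G')" unfolding G'_def by (auto intro: con_mono)
  have deg: "degree G' z = count {#v, v#} z + degree G z" for z
    using l unfolding degree_def G'_def by (simp, intro sum.cong) auto
  then show "degree G' v = degree G v + 2" by simp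
  have "(\<Sum>x\<in>verts G'. weight G' x) + 1 = (\<Sum>x\<in>verts G. weight G x)"
    using v w by (simp add: G'_def sum.remove)
  moreover have "3 \<le> 2 * weight G' z + degree G' z" if "z \<in> verts G" for z
    using st that w by (auto simp: stable_con_def deg) (auto simp: G'_def)
  ultimately show "stable_con g G'"
    using stable_con_transfer[OF st wm c] l by (simp add: G'_def)
  have "trees (verts G) (ends G) (edges G) = trees (verts G) (ends G') (edges G)"
    by (rule trees_cong) (use eq in \<open>simp add: G'_def\<close>)
  also have "\<dots> \<subseteq> trees (verts G') (ends G') (edges G')" by (auto simp: trees_def G'_def)
  finally show "complexity G \<le> complexity G'"
    using complexity_eq weighted_multigraph.complexity_eq[OF wm] weighted_multigraph.finite_edges[OF wm]
    by (simp add: card_mono finite_trees)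
qed

text \<open>Every spanning tree contains a bridge, so the deletion term of deletion-contraction
  vanishes. The merged vertex collects two excesses of at least 1 each, hence the 4 in the
  conclusion.\<close>

lemma contract_bridge:
  fixes G :: "('v, 'e) wmgraph"
  assumes st: "stable_con g G" and e: "e \<in> edges G" "ends G e = {#u, v#}" "u \<noteq> v"
    and br: "\<not> con (verts G) (ends G) (edges G - {e})"
  obtains G' :: "('v, 'e) wmgraph" where "stable_con g G'" "complexity G' = complexity G" "u \<in> verts G'"
    "4 \<le> 2 * weight G' u + degree G' u" "card (edges G') < card (edges G)"
proof -
  interpret weighted_multigraph G by (rule stable_con_wm[OF st])
  note [simp] = finite_verts finite_edges
  let ?f = "\<lambda>x. image_mset (id(v := u)) (ends G x)"
  have uv: "u \<in> verts G" "v \<in> verts G" using ends_in_verts[OF e(1)] e by auto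
  define G' where "G' = \<lparr>verts = verts G - {v}, edges = edges G - {e}, ends = ?f,
    weight = (weight G)(u := weight G u + weight G v)\<rparr>"
  have wm: "weighted_multigraph G'"
  proof
    fix x assume "x \<in> edges G'"
    then show "size (ends G' x) = 2" "set_mset (ends G' x) \<subseteq> verts G'"
      using size_ends[of x] ends_in_verts[of x] uv e by (auto simp: G'_def)
  qed (auto simp: G'_def)
  have Ee: "insert e (edges G - {e}) = edges G" using e by auto
  have c: "con (verts G') (ends G') (edges G')"
    using con_contract[of "ends G" e u v "verts G" "edges G - {e}"] e uv stable_con_con[OF st] Ee
    by (simp add: G'_def)
  have cE: "card (edges G - {e}) + 1 = card (edges G)" using e by (metis Suc_eq_plus1 card_Suc_Diff1 finite_edges)
  have cV: "card (verts G - {v}) + 1 = card (verts G)" using uv by (metis Suc_eq_plus1 card_Suc_Diff1 finite_verts)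
  have ct: "count (?f x) z = (if z = v then 0 else if z = u then count (ends G x) u + count (ends G x) v
    else count (ends G x) z)" if x: "x \<in> edges G" for x z
  proof -
    obtain a b where "ends G x = {#a, b#}" using obtain_ends[OF x] by metis
    then show ?thesis using e(3) by auto
  qed
  have degG: "degree G z = count {#u, v#} z + (\<Sum>x\<in>edges G - {e}. count (ends G x) z)" for z
    using e by (simp add: degree_def sum.remove)
  have "degree G' u = (\<Sum>x\<in>edges G - {e}. count (ends G x) u + count (ends G x) v)"
    unfolding degree_def G'_def by (simp, rule sum.cong) (use ct e in auto)
  then have du: "degree G' u + 2 = degree G u + degree G v"
    using degG[of u] degG[of v] e(3) by (simp add: sum.distrib)
  have dz: "degree G' z = degree G z" if "z \<noteq> u" "z \<noteq> v" for z
    unfolding degG unfolding degree_def G'_def using that by (simp, intro sum.cong) (use ct e in auto)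
  have ge: "3 \<le> 2 * weight G z + degree G z" if "z \<in> verts G" for z
    using st that by (auto simp: stable_con_def)
  have four: "4 \<le> 2 * weight G' u + degree G' u"
    using du ge[OF uv(1)] ge[OF uv(2)] by (simp add: G'_def)
  have "3 \<le> 2 * weight G' z + degree G' z" if "z \<in> verts G'" for z
    using four dz[of z] ge[of z] that by (cases "z = u") (auto simp: G'_def)
  moreover have "(\<Sum>x\<in>verts G'. weight G' x) = (\<Sum>x\<in>verts G. weight G x)"
  proof -
    have "(\<Sum>x\<in>verts G'. weight G' x) = weight G u + weight G v + (\<Sum>x\<in>verts G - {v} - {u}. weight G x)"
      using uv e by (simp add: G'_def sum.remove[of _ u])
    also have "\<dots> = (\<Sum>x\<in>verts G. weight G x)"
      using uv e by (simp add: sum.remove[of "verts G" v] sum.remove[of "verts G - {v}" u])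
    finally show ?thesis .
  qed
  ultimately have st': "stable_con g G'"
    using stable_con_transfer[OF st wm c] cE cV by (simp add: G'_def)
  have "card (trees (verts G) (ends G) (insert e (edges G - {e}))) =
    card (trees (verts G) (ends G) (edges G - {e})) + card (trees (verts G - {v}) ?f (edges G - {e}))"
    by (rule card_trees_insert) (use e uv in auto)
  moreover have "trees (verts G) (ends G) (edges G - {e}) = {}"
    using br con_mono by (auto simp: trees_def)
  ultimately have "complexity G' = complexity G"
    using complexity_eq weighted_multigraph.complexity_eq[OF wm] Ee by (simp add: G'_def)
  with st' four show thesis using that[of G'] uv e cE by (auto simp: G'_def)
qed

section \<open>Graphs of maximal complexity\<close>

text \<open>Labels are fixed to \<open>nat\<close> so that maximality ranges over a single type in
  which fresh vertices and edges always exist.\<close>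

definition extremal :: "int \<Rightarrow> (nat, nat) wmgraph \<Rightarrow> bool" where
  "extremal g G \<longleftrightarrow> stable_con g G \<and>
     (\<forall>G' :: (nat, nat) wmgraph. stable_con g G' \<longrightarrow> complexity G' \<le> complexity G)"

lemma extremalD: "extremal g G \<Longrightarrow> stable_con g G"
  by (simp add: extremal_def)

lemma extremal_ge:
  "extremal g G \<Longrightarrow> stable_con g G' \<Longrightarrow> complexity G \<le> complexity G' \<Longrightarrow> extremal g G'"
  unfolding extremal_def using order_trans by blast

lemma extremal_not_less:
  "extremal g G \<Longrightarrow> stable_con g (G' :: (nat, nat) wmgraph) \<Longrightarrow> \<not> complexity G < complexity G'"
  by (auto simp: extremal_def not_less)

text \<open>Serves to pick edges at \<open>v\<close> one after another, as long as the ends already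
  used fall short of the degree.\<close>

lemma (in weighted_multigraph) other_edge_at:
  assumes "A \<subseteq> edges G" "(\<Sum>e\<in>A. count (ends G e) v) < degree G v"
  obtains e where "e \<in> edges G" "e \<notin> A" "v \<in># ends G e"
proof (rule ccontr)
  assume "\<not> thesis"
  then have "count (ends G e) v = 0" if "e \<in> edges G - A" for e
    using \<open>\<And>e. e \<in> edges G \<Longrightarrow> e \<notin> A \<Longrightarrow> v \<in># ends G e \<Longrightarrow> thesis\<close> \<open>e \<in> edges G - A\<close>
    by (auto simp: count_eq_zero_iff)
  then have "degree G v = (\<Sum>e\<in>A. count (ends G e) v)"
    unfolding degree_def by (intro sum.mono_neutral_right) (use assms finite_edges in auto)
  then show False using assms by simp
qed

lemma extremal_split:
  assumes ex: "extremal g G" and v: "v \<in> verts G" "4 \<le> 2 * weight G v + degree G v"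
    and e: "e1 \<in> edges G" "e2 \<in> edges G" "e1 \<noteq> e2" "v \<in># ends G e1" "v \<in># ends G e2"
    and n: "n \<notin> verts G"
  shows "\<not> con (insert n (verts G)) (split_ends (ends G) v n {e1, e2}) (edges G)"
proof
  assume "con (insert n (verts G)) (split_ends (ends G) v n {e1, e2}) (edges G)"
  moreover obtain k where "k \<notin> edges G"
    using ex_new_if_finite[OF infinite_UNIV_nat
      weighted_multigraph.finite_edges[OF stable_con_wm[OF extremalD[OF ex]]]] by blast
  ultimately show False
    using split_improves[OF extremalD[OF ex] v e n] extremal_not_less[OF ex] by blast
qed

lemma fresh_vertex:
  assumes "extremal g G" obtains n where "n \<notin> verts G"
  using ex_new_if_finite[OF infinite_UNIV_nat
    weighted_multigraph.finite_verts[OF stable_con_wm[OF extremalD[OF assms]]]] by blast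

lemma extremal_loop:
  assumes ex: "extremal g G" and v: "v \<in> verts G" "4 \<le> 2 * weight G v + degree G v"
    and l: "l \<in> edges G" "ends G l = {#v, v#}" and e: "e \<in> edges G" "e \<noteq> l" "v \<in># ends G e"
  shows False
proof -
  obtain n where n: "n \<notin> verts G" using fresh_vertex[OF ex] .
  obtain b where b: "ends G e = {#v, b#}"
    using weighted_multigraph.obtain_ends_at[OF stable_con_wm[OF extremalD[OF ex]] e(1,3)] .
  have "con (insert n (verts G)) (split_ends (ends G) v n {l, e}) (edges G)"
    by (rule con_split_loop[where b = b]) (use stable_con_con[OF extremalD[OF ex]] v l b in auto)
  moreover have "v \<in># ends G l" using l by simp
  ultimately show False using extremal_split[OF ex v l(1) e(1) e(2)[symmetric] _ e(3) n] by blast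
qed

lemma extremal_add_loop:
  assumes ex: "extremal g G" and v: "v \<in> verts G" "0 < weight G v"
  obtains G' l where "extremal g G'" "v \<in> verts G'" "l \<notin> edges G" "edges G' = insert l (edges G)"
    "ends G' l = {#v, v#}" "\<And>e. e \<noteq> l \<Longrightarrow> ends G' e = ends G e"
    "weight G' v + 1 = weight G v" "degree G' v = degree G v + 2"
proof -
  obtain l where l: "l \<notin> edges G"
    using ex_new_if_finite[OF infinite_UNIV_nat
      weighted_multigraph.finite_edges[OF stable_con_wm[OF extremalD[OF ex]]]] by blast
  note L = add_loop[OF extremalD[OF ex] v l]
  show thesis
    by (rule that[OF extremal_ge[OF ex L(1,2)] _ l _ _ _ _ L(3)]) (use v in auto)
qed

text \<open>A split moves ends of two distinct edges: here the loop bought with a unit of weight,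
  and \<open>e\<close>.\<close>

lemma extremal_weight:
  assumes ex: "extremal g G" and v: "v \<in> verts G" "4 \<le> 2 * weight G v + degree G v" "0 < weight G v"
    and e: "e \<in> edges G" "v \<in># ends G e"
  shows False
proof -
  obtain G' l where G': "extremal g G'" "v \<in> verts G'" "l \<notin> edges G" "edges G' = insert l (edges G)"
    "ends G' l = {#v, v#}" "\<And>e. e \<noteq> l \<Longrightarrow> ends G' e = ends G e"
    "weight G' v + 1 = weight G v" "degree G' v = degree G v + 2"
    using extremal_add_loop[OF ex v(1,3)] by blast
  have "e \<noteq> l" using e G' by auto
  then show False
    using extremal_loop[OF G'(1,2) _ _ G'(5), of e] G'(4,7,8) G'(6)[of e] e v by auto
qed

lemma degree_0_single:
  assumes st: "stable_con g G" and v: "v \<in> verts G" "degree G v = 0"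
  shows "verts G = {v}" "edges G = {}"
proof -
  interpret weighted_multigraph G by (rule stable_con_wm[OF st])
  have no: "v \<notin># ends G e" if "e \<in> edges G" for e
    using v that finite_edges by (auto simp: degree_def count_eq_zero_iff)
  have "edge_const (ends G) (edges G) (\<lambda>x. x = v)"
    unfolding edge_const_def using no by metis
  from conD[OF stable_con_con[OF st] this] show V: "verts G = {v}" using v by auto
  show "edges G = {}"
  proof (rule ccontr)
    assume "edges G \<noteq> {}"
    then obtain e where e: "e \<in> edges G" by auto
    obtain a b where "ends G e = {#a, b#}" "a \<in> verts G" using obtain_ends[OF e] .
    then show False using no[OF e] V by auto
  qed
qed

text \<open>Positive weight, a loop, or a non-bridge at \<open>v\<close> each lead to an improving
  split. Only a bridge at \<open>v\<close> calls on the induction hypothesis, for the contracted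
  graph, which is again extremal.\<close>

lemma extremal_excess:
  assumes "extremal g G" "3 \<le> g" "v \<in> verts G" "4 \<le> 2 * weight G v + degree G v"
  shows False
  using assms
proof (induction "card (edges G)" arbitrary: G v rule: less_induct)
  case less
  note ex = less.prems(1) and v = less.prems(3,4)
  note st = extremalD[OF ex]
  interpret weighted_multigraph G by (rule stable_con_wm[OF st])
  consider "0 < weight G v" "degree G v = 0" | "0 < weight G v" "0 < degree G v" | "weight G v = 0" by auto
  then show False
  proof cases
    case 1
    \<comment> \<open>An isolated vertex is the whole graph. One loop is added first to have an edge
      to split with, and weight at least 2 remains.\<close>
    have "g = int (weight G v)" using st degree_0_single[OF st v(1) 1(2)] by (simp add: stable_con_def)
    then have w: "3 \<le> weight G v" using less.prems(2) by simp
    obtain G' l where G': "extremal g G'" "v \<in> verts G'" "l \<notin> edges G" "edges G' = insert l (edges G)"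
      "ends G' l = {#v, v#}" "\<And>e. e \<noteq> l \<Longrightarrow> ends G' e = ends G e"
      "weight G' v + 1 = weight G v" "degree G' v = degree G v + 2"
      using extremal_add_loop[OF ex v(1) 1(1)] by blast
    show False by (rule extremal_weight[OF G'(1,2), of l]) (use G'(4,5,7,8) w in auto)
  next
    case 2
    obtain e where "e \<in> edges G" "v \<in># ends G e"
      using other_edge_at[of "{}" v] 2 by auto
    then show False using extremal_weight[OF ex v 2(1)] by blast
  next
    case 3
    then have d: "4 \<le> degree G v" using v by simp
    show False
    proof (cases "\<exists>l\<in>edges G. ends G l = {#v, v#}")
      case True
      then obtain l where l: "l \<in> edges G" "ends G l = {#v, v#}" by blast
      obtain e where "e \<in> edges G" "e \<notin> {l}" "v \<in># ends G e"
        using other_edge_at[of "{l}" v] l d by auto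
      then show False using extremal_loop[OF ex v l] by blast
    next
      case False
      \<comment> \<open>Without loops every edge uses a single end at \<open>v\<close>, so degree 4
        suffices to pick three distinct edges.\<close>
      have one: "count (ends G e) v = 1" if e: "e \<in> edges G" "v \<in># ends G e" for e
      proof -
        obtain b where "ends G e = {#v, b#}" using obtain_ends_at[OF e] .
        then show ?thesis using False e by auto
      qed
      obtain e where e: "e \<in> edges G" "v \<in># ends G e" using other_edge_at[of "{}" v] d by auto
      obtain h where h: "h \<in> edges G" "h \<noteq> e" "v \<in># ends G h"
        using other_edge_at[of "{e}" v] d e one[OF e] by auto
      obtain h' where h': "h' \<in> edges G" "h' \<noteq> e" "h' \<noteq> h" "v \<in># ends G h'"
        using other_edge_at[of "{e, h}" v] d e h one[OF e] one[OF h(1,3)] by auto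
      obtain z where z: "ends G e = {#v, z#}" "z \<in> verts G" using obtain_ends_at[OF e] .
      obtain a where a: "ends G h = {#v, a#}" using obtain_ends_at[OF h(1,3)] .
      obtain b where b: "ends G h' = {#v, b#}" using obtain_ends_at[OF h'(1,4)] .
      show False
      proof (cases "con (verts G) (ends G) (edges G - {e})")
        case True
        obtain n where n: "n \<notin> verts G" using fresh_vertex[OF ex] .
        show False
          using con_split_nonbridge[OF True v(1) z(2) e(1) z(1) h(1) a h'(1) b, of n] h h'
            extremal_split[OF ex v e(1) h(1) _ e(2) h(3) n] extremal_split[OF ex v e(1) h'(1) _ e(2) h'(4) n]
          by metis
      next
        case br: False
        have "v \<noteq> z" using False z e by auto
        obtain G' :: "(nat, nat) wmgraph" where G': "stable_con g G'" "complexity G' = complexity G" "v \<in> verts G'"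
          "4 \<le> 2 * weight G' v + degree G' v" "card (edges G') < card (edges G)"
          using contract_bridge[OF st e(1) z(1) \<open>v \<noteq> z\<close> br] .
        have "extremal g G'" using extremal_ge[OF ex G'(1)] G'(2) by simp
        then show False using less.hyps[OF G'(5) _ less.prems(2) G'(3,4)] by blast
      qed
    qed
  qed
qed

text \<open>Contracting a bridge would give an extremal graph with a vertex of excess at least 2. A
  loop never disconnects when removed.\<close>

lemma extremal_bridgeless:
  assumes ex: "extremal g G" "3 \<le> g" and e: "e \<in> edges G"
  shows "con (verts G) (ends G) (edges G - {e})"
proof (rule ccontr)
  assume br: "\<not> ?thesis"
  note st = extremalD[OF ex(1)]
  interpret weighted_multigraph G by (rule stable_con_wm[OF st])
  obtain u v where uv: "ends G e = {#u, v#}" using obtain_ends[OF e] .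
  show False
  proof (cases "u = v")
    case True
    have Ee: "insert e (edges G - {e}) = edges G" using e by auto
    have "edge_const (ends G) (edges G) P" if "edge_const (ends G) (edges G - {e}) P" for P
      using edge_const_insert[of "ends G" e u v "edges G - {e}" P] uv True that Ee by simp
    then show False using con_weaken[OF stable_con_con[OF st]] br by blast
  next
    case False
    obtain G' :: "(nat, nat) wmgraph" where G': "stable_con g G'" "complexity G' = complexity G" "u \<in> verts G'"
      "4 \<le> 2 * weight G' u + degree G' u" "card (edges G') < card (edges G)"
      using contract_bridge[OF st e uv False br] .
    have "extremal g G'" using extremal_ge[OF ex(1) G'(1)] G'(2) by simp
    then show False using extremal_excess[OF _ ex(2) G'(3,4)] by blast
  qed
qed

text \<open>Otherwise the cut around \<open>v\<close> consists of \<open>e\<close> alone, and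
  \<open>e\<close> is a bridge.\<close>

lemma extremal_not_pendant:
  assumes ex: "extremal g G" "3 \<le> g" and e: "e \<in> edges G" "ends G e = {#v, b#}" "b \<noteq> v"
  shows "\<exists>h\<in>edges G. h \<noteq> e \<and> (\<exists>c. c \<noteq> v \<and> ends G h = {#v, c#})"
proof (rule ccontr)
  assume no: "\<not> ?thesis"
  interpret weighted_multigraph G by (rule stable_con_wm[OF extremalD[OF ex(1)]])
  have "edge_const (ends G) (edges G - {e}) (\<lambda>x. x = v)"
    unfolding edge_const_def
  proof (intro ballI)
    fix d x y assume d: "d \<in> edges G - {e}" and xy: "x \<in># ends G d" "y \<in># ends G d"
    show "(x = v) = (y = v)"
    proof (cases "v \<in># ends G d")
      case True
      then obtain c where "ends G d = {#v, c#}" using obtain_ends_at[of d v] d by auto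
      then show ?thesis using no d xy by auto
    qed (use xy in auto)
  qed
  from conD[OF extremal_bridgeless[OF ex e(1)] this, of v b] show False
    using ends_in_verts[OF e(1)] e by auto
qed

text \<open>Excess 1 leaves weight 0 with degree 3, or weight 1 with degree 1; in the latter case
  the only edge at \<open>v\<close> would be a bridge.\<close>

lemma extremal_trivalent:
  assumes ex: "extremal g G" "3 \<le> g" and v: "v \<in> verts G"
  shows "weight G v = 0" "degree G v = 3"
proof -
  interpret weighted_multigraph G by (rule stable_con_wm[OF extremalD[OF ex(1)]])
  have "\<not> 4 \<le> 2 * weight G v + degree G v" using extremal_excess[OF ex v] by blast
  moreover have "3 \<le> 2 * weight G v + degree G v"
    using extremalD[OF ex(1)] v by (auto simp: stable_con_def)
  ultimately have eq: "2 * weight G v + degree G v = 3" by simp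
  have "\<not> degree G v = 1"
  proof
    assume d: "degree G v = 1"
    obtain e where e: "e \<in> edges G" "v \<in># ends G e" using other_edge_at[of "{}" v] d by auto
    obtain b where b: "ends G e = {#v, b#}" using obtain_ends_at[OF e] .
    have le: "(\<Sum>x\<in>A. count (ends G x) v) \<le> 1" if "A \<subseteq> edges G" for A
      using sum_mono2[OF finite_edges that, of "\<lambda>x. count (ends G x) v"] d by (simp add: degree_def)
    have "b \<noteq> v" using le[of "{e}"] e b by auto
    then obtain h c where "h \<in> edges G" "h \<noteq> e" "ends G h = {#v, c#}"
      using extremal_not_pendant[OF ex e(1) b] by blast
    then show False using le[of "{e, h}"] e b by auto
  qed
  with eq show "weight G v = 0" "degree G v = 3" by presburger+
qed

text \<open>A loop takes two of the three ends at \<open>v\<close>, so the edge with the third end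
  would be a bridge.\<close>

lemma extremal_loopless:
  assumes ex: "extremal g G" "3 \<le> g" and l: "l \<in> edges G"
  shows "ends G l \<noteq> {#v, v#}"
proof
  assume lv: "ends G l = {#v, v#}"
  interpret weighted_multigraph G by (rule stable_con_wm[OF extremalD[OF ex(1)]])
  have v: "v \<in> verts G" using ends_in_verts[OF l] lv by simp
  note d = extremal_trivalent(2)[OF ex v]
  obtain e where e: "e \<in> edges G" "e \<noteq> l" "v \<in># ends G e"
    using other_edge_at[of "{l}" v] d l lv by auto
  obtain b where b: "ends G e = {#v, b#}" using obtain_ends_at[OF e(1,3)] .
  have le: "(\<Sum>x\<in>A. count (ends G x) v) \<le> 3" if "A \<subseteq> edges G" for A
    using sum_mono2[OF finite_edges that, of "\<lambda>x. count (ends G x) v"] d by (simp add: degree_def)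
  have "b \<noteq> v" using le[of "{e, l}"] e b lv l by auto
  then obtain h c where h: "h \<in> edges G" "h \<noteq> e" "c \<noteq> v" "ends G h = {#v, c#}"
    using extremal_not_pendant[OF ex e(1) b] by blast
  then have "h \<noteq> l" using lv by auto
  then show False using le[of "{e, h, l}"] e h b lv l by auto
qed

section \<open>The Whitehead move on parallel edges\<close>

lemma card_exchange:
  assumes "finite T" "a \<in> T" "b \<notin> T" shows "card (insert b (T - {a})) = card T"
  using assms card_Suc_Diff1[of T a] by (simp add: card_insert_disjoint)

text \<open>The situation after deletion of the third edge \<open>ux\<close> at \<open>u\<close>:
  the edges at \<open>u\<close> are \<open>e1\<close>, \<open>e2\<close>, those at \<open>v\<close>
  are \<open>e1\<close>, \<open>e2\<close>, \<open>h\<close>, those at \<open>x\<close> are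
  \<open>p\<close>, \<open>q\<close>. The outer ends \<open>y\<close>, \<open>r\<close>,
  \<open>s\<close> may coincide. \<open>con_E\<close> says that the deleted edge was not a
  bridge.\<close>

locale parallel_switch =
  fixes V :: "'v set" and E :: "'e set" and f :: "'e \<Rightarrow> 'v multiset"
    and e1 e2 h p q :: 'e and u v x y r s :: 'v
  assumes fin: "finite V" "finite E"
    and size_f: "e \<in> E \<Longrightarrow> size (f e) = 2"
    and f_in: "e \<in> E \<Longrightarrow> set_mset (f e) \<subseteq> V"
    and edges_in: "e1 \<in> E" "e2 \<in> E" "h \<in> E" "p \<in> E" "q \<in> E"
    and edges_distinct: "distinct [e1, e2, h, p, q]"
    and uvx: "distinct [u, v, x]" "u \<in> V" "v \<in> V" "x \<in> V"
    and yrs: "y \<in> V - {u, v, x}" "r \<in> V - {u, v, x}" "s \<in> V - {u, v, x}"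
    and f: "f e1 = {#u, v#}" "f e2 = {#u, v#}" "f h = {#v, y#}" "f p = {#x, r#}" "f q = {#x, s#}"
    and rest: "e \<in> E - {e1, e2, h, p, q} \<Longrightarrow> set_mset (f e) \<inter> {u, v, x} = {}"
    and con_E: "con V f E"
begin

text \<open>\<open>e1\<close> and \<open>q\<close> exchange their ends at \<open>u\<close> and
  \<open>x\<close>, so degrees are preserved, and so is the graph obtained by identifying
  \<open>u\<close> with \<open>x\<close>.\<close>

definition f' :: "'e \<Rightarrow> 'v multiset" where
  "f' = f(e1 := {#x, v#}, q := {#u, s#})"

definition R :: "'e set" where "R = E - {e1, e2, h, p, q}"

lemma ne: "e1 \<noteq> e2" "e1 \<noteq> h" "e1 \<noteq> p" "e1 \<noteq> q" "e2 \<noteq> h" "e2 \<noteq> p" "e2 \<noteq> q" "h \<noteq> p" "h \<noteq> q" "p \<noteq> q"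
    "u \<noteq> v" "u \<noteq> x" "v \<noteq> x"
    "e2 \<noteq> e1" "h \<noteq> e1" "p \<noteq> e1" "q \<noteq> e1" "h \<noteq> e2" "p \<noteq> e2" "q \<noteq> e2" "p \<noteq> h" "q \<noteq> h" "q \<noteq> p"
    "v \<noteq> u" "x \<noteq> u" "x \<noteq> v"
  using edges_distinct uvx by auto

lemma f': "f' e1 = {#x, v#}" "f' e2 = {#u, v#}" "f' h = {#v, y#}" "f' p = {#x, r#}" "f' q = {#u, s#}"
  and f'_rest: "e \<noteq> e1 \<Longrightarrow> e \<noteq> q \<Longrightarrow> f' e = f e"
  using ne f by (auto simp: f'_def)

lemma edge_const_f:
  assumes "T \<subseteq> E"
  shows "edge_const f T P \<longleftrightarrow> (e1 \<in> T \<longrightarrow> P u = P v) \<and> (e2 \<in> T \<longrightarrow> P u = P v) \<and>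
    (h \<in> T \<longrightarrow> P v = P y) \<and> (p \<in> T \<longrightarrow> P x = P r) \<and> (q \<in> T \<longrightarrow> P x = P s) \<and>
    edge_const f (T \<inter> R) P" (is "_ \<longleftrightarrow> ?rhs")
proof
  assume c: "edge_const f T P"
  show ?rhs using edge_const_edge[OF c _ f(1)] edge_const_edge[OF c _ f(2)] edge_const_edge[OF c _ f(3)]
    edge_const_edge[OF c _ f(4)] edge_const_edge[OF c _ f(5)] edge_const_mono[OF c, of "T \<inter> R"] by blast
next
  assume rhs: ?rhs
  show "edge_const f T P"
    unfolding edge_const_def
  proof (intro ballI)
    fix e a b assume e: "e \<in> T" "a \<in># f e" "b \<in># f e"
    then consider "e = e1" | "e = e2" | "e = h" | "e = p" | "e = q" | "e \<in> T \<inter> R"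
      using assms by (auto simp: R_def)
    then show "P a = P b"
    proof cases
      case 6 then show ?thesis using rhs e(2,3) unfolding edge_const_def by blast
    qed (use rhs e f in auto)
  qed
qed

lemma edge_const_f':
  assumes "T \<subseteq> E"
  shows "edge_const f' T P \<longleftrightarrow> (e1 \<in> T \<longrightarrow> P x = P v) \<and> (e2 \<in> T \<longrightarrow> P u = P v) \<and>
    (h \<in> T \<longrightarrow> P v = P y) \<and> (p \<in> T \<longrightarrow> P x = P r) \<and> (q \<in> T \<longrightarrow> P u = P s) \<and>
    edge_const f (T \<inter> R) P" (is "_ \<longleftrightarrow> ?rhs")
proof
  assume c: "edge_const f' T P"
  have "edge_const f' (T \<inter> R) P" using edge_const_mono[OF c, of "T \<inter> R"] by blast
  moreover have "edge_const f' (T \<inter> R) P = edge_const f (T \<inter> R) P"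
    by (rule edge_const_cong) (auto simp: R_def f'_rest)
  ultimately show ?rhs
    using edge_const_edge[OF c _ f'(1)] edge_const_edge[OF c _ f'(2)] edge_const_edge[OF c _ f'(3)]
    edge_const_edge[OF c _ f'(4)] edge_const_edge[OF c _ f'(5)] by blast
next
  assume rhs: ?rhs
  show "edge_const f' T P"
    unfolding edge_const_def
  proof (intro ballI)
    fix e a b assume e: "e \<in> T" "a \<in># f' e" "b \<in># f' e"
    then consider "e = e1" | "e = e2" | "e = h" | "e = p" | "e = q" | "e \<in> T \<inter> R"
      using assms by (auto simp: R_def)
    then show "P a = P b"
    proof cases
      case 6
      then have "f' e = f e" by (auto simp: R_def f'_rest)
      then show ?thesis using 6 rhs e(2,3) unfolding edge_const_def by metis
    qed (use rhs e f' in auto)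
  qed
qed

text \<open>The edges in \<open>R\<close> avoid \<open>u\<close>, \<open>v\<close>,
  \<open>x\<close>, so the values there may be replaced by any \<open>a\<close>, \<open>b\<close>,
  \<open>c\<close> that suit the edges of \<open>T\<close> under \<open>f\<close>. In this way a
  colouring coming from \<open>f'\<close> can be tested against connectivity under
  \<open>f\<close>.\<close>

lemma rest_const:
  assumes c: "con V f T" "T \<subseteq> E" and P: "edge_const f (T \<inter> R) P"
    and ab: "e1 \<in> T \<or> e2 \<in> T \<Longrightarrow> a = b" "h \<in> T \<Longrightarrow> b = P y" "p \<in> T \<Longrightarrow> c = P r" "q \<in> T \<Longrightarrow> c = P s"
    and z: "z \<in> V - {u, v, x}"
  shows "P z = P y"
proof -
  let ?P = "P(u := a, v := b, x := c)"
  have "edge_const f (T \<inter> R) ?P"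
    unfolding edge_const_def
  proof (intro ballI)
    fix e i j assume e: "e \<in> T \<inter> R" "i \<in># f e" "j \<in># f e"
    then have "i \<notin> {u, v, x}" "j \<notin> {u, v, x}" using rest[of e] unfolding R_def by blast+
    then have "?P i = P i" "?P j = P j" by auto
    then show "?P i = ?P j" using P e unfolding edge_const_def by metis
  qed
  then have "edge_const f T ?P"
    unfolding edge_const_f[OF c(2)] using ab yrs ne by auto
  from conD[OF c(1) this, of z y] show ?thesis using z yrs by auto
qed

lemma con_f'I:
  assumes "\<And>P. edge_const f' T P \<Longrightarrow> (\<forall>z\<in>V - {u, v, x}. P z = P y) \<and> P u = P y \<and> P v = P y \<and> P x = P y"
  shows "con V f' T"
proof (rule conI[of y])
  fix P z assume "edge_const f' T P" "z \<in> V"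
  then show "P z = P y" using assms[of P] by (cases "z \<in> {u, v, x}") auto
qed (use yrs in auto)

text \<open>The cuts around {u, v}, {u} and {x} consist of \<open>h\<close>, of \<open>e1\<close>
  and \<open>e2\<close>, and of \<open>p\<close> and \<open>q\<close>.\<close>

lemma tree_meets:
  assumes c: "con V f T" "T \<subseteq> E"
  shows "h \<in> T" "e1 \<in> T \<or> e2 \<in> T" "p \<in> T \<or> q \<in> T"
proof -
  have R: "edge_const f (T \<inter> R) P" if "\<And>z. z \<notin> {u, v, x} \<Longrightarrow> \<not> P z" for P
    unfolding edge_const_def using rest that unfolding R_def by blast
  show "h \<in> T"
  proof (rule ccontr)
    assume "h \<notin> T"
    then have "edge_const f T (\<lambda>z. z \<in> {u, v})"
      unfolding edge_const_f[OF c(2)] using yrs ne by (intro conjI R) auto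
    from conD[OF c(1) this, of u y] show False using uvx yrs by auto
  qed
  show "e1 \<in> T \<or> e2 \<in> T"
  proof (rule ccontr)
    assume "\<not> (e1 \<in> T \<or> e2 \<in> T)"
    then have "edge_const f T (\<lambda>z. z = u)"
      unfolding edge_const_f[OF c(2)] using yrs ne by (intro conjI R) auto
    from conD[OF c(1) this, of u y] show False using uvx yrs by auto
  qed
  show "p \<in> T \<or> q \<in> T"
  proof (rule ccontr)
    assume "\<not> (p \<in> T \<or> q \<in> T)"
    then have "edge_const f T (\<lambda>z. z = x)"
      unfolding edge_const_f[OF c(2)] using yrs ne by (intro conjI R) auto
    from conD[OF c(1) this, of x y] show False using uvx yrs by auto
  qed
qed

text \<open>Of two parallel edges one is redundant for connectivity, against the minimal number of
  edges.\<close>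

lemma tree_not_both:
  assumes T: "T \<in> trees V f E" shows "\<not> (e1 \<in> T \<and> e2 \<in> T)"
proof
  assume e: "e1 \<in> T \<and> e2 \<in> T"
  have TE: "T \<subseteq> E" and c: "con V f T" and cT: "card T + 1 = card V" using T by (auto simp: trees_def)
  have "finite T" using TE fin finite_subset by blast
  have "T - {e2} \<subseteq> E" using TE by auto
  note ec = edge_const_f[OF this] edge_const_f[OF TE]
  have "(T - {e2}) \<inter> R = T \<inter> R" by (auto simp: R_def)
  then have "edge_const f T P" if "edge_const f (T - {e2}) P" for P
    using that e ne unfolding ec by simp
  then have "con V f (T - {e2})" by (rule con_weaken[OF c])
  then have "card V \<le> card (T - {e2}) + 1"
    by (rule con_card_le[rotated 2]) (use fin \<open>finite T\<close> TE size_f f_in in auto)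
  moreover have "card (T - {e2}) + 1 = card T" using e \<open>finite T\<close> by (metis Suc_eq_plus1 card_Suc_Diff1)
  ultimately show False using cT by simp
qed

text \<open>The injection from the trees for \<open>f\<close> to the trees for \<open>f'\<close> keeps a tree if possible and
  exchanges one edge otherwise; it is determined by the trace on \<open>{e1, e2, p, q}\<close>.\<close>

definition \<phi> :: "'e set \<Rightarrow> 'e set" where
  "\<phi> T = (if p \<in> T \<and> q \<in> T then
      (if con V f' T then T else if e1 \<in> T then insert e2 (T - {p}) else insert e1 (T - {q}))
    else if e1 \<in> T \<and> p \<in> T then insert e2 (T - {p})
    else if e2 \<in> T \<and> q \<in> T then insert p (T - {e2})
    else T)"

text \<open>Every tree for \<open>f\<close> contains exactly one of \<open>e1\<close>,
  \<open>e2\<close>. If its image contains both, one was inserted, and the presence of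
  \<open>p\<close> tells in exchange for which edge; if it contains neither, \<open>e2\<close> was
  traded for \<open>p\<close>.\<close>

definition \<phi>_inv :: "'e set \<Rightarrow> 'e set" where
  "\<phi>_inv T = (if e1 \<in> T \<and> e2 \<in> T then (if p \<in> T then insert q (T - {e1}) else insert p (T - {e2}))
    else if e1 \<notin> T \<and> e2 \<notin> T then insert e2 (T - {p})
    else T)"

lemma \<phi>_inv:
  assumes T: "T \<in> trees V f E" shows "\<phi>_inv (\<phi> T) = T"
proof -
  have TE: "T \<subseteq> E" and c: "con V f T" using T by (auto simp: trees_def)
  note t = tree_meets[OF c TE] tree_not_both[OF T]
  consider "e1 \<in> T" "e2 \<notin> T" "p \<in> T" "q \<in> T" | "e1 \<notin> T" "e2 \<in> T" "p \<in> T" "q \<in> T"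
    | "e1 \<in> T" "e2 \<notin> T" "p \<in> T" "q \<notin> T" | "e1 \<in> T" "e2 \<notin> T" "p \<notin> T" "q \<in> T"
    | "e1 \<notin> T" "e2 \<in> T" "p \<in> T" "q \<notin> T" | "e1 \<notin> T" "e2 \<in> T" "p \<notin> T" "q \<in> T"
    using t by blast
  then show ?thesis
    by cases (simp_all add: \<phi>_def \<phi>_inv_def ne, auto simp: ne)
qed

text \<open>If both \<open>T\<close> and the exchanged set leave a cut, given by \<open>P\<close> and \<open>Q\<close>, then the places where
  \<open>P\<close> and \<open>Q\<close> agree form a cut of \<open>T\<close> in the original graph, since \<open>y\<close> is with \<open>r\<close> in one of
  the cuts and with \<open>s\<close> in the other.\<close>

lemma con_exchange:
  assumes c: "con V f T" "T \<subseteq> E" and no: "\<not> con V f' T"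
    and t: "h \<in> T" "p \<in> T" "q \<in> T"
  shows "e1 \<in> T \<Longrightarrow> e2 \<notin> T \<Longrightarrow> con V f' (insert e2 (T - {p}))"
    and "e2 \<in> T \<Longrightarrow> e1 \<notin> T \<Longrightarrow> con V f' (insert e1 (T - {q}))"
proof -
  obtain P where P: "edge_const f' T P"
    "\<not> ((\<forall>z\<in>V - {u, v, x}. P z = P y) \<and> P u = P y \<and> P v = P y \<and> P x = P y)"
    using con_f'I no by blast
  note P' = P(1)[unfolded edge_const_f'[OF c(2)]]
  \<comment> \<open>With \<open>p\<close> and \<open>q\<close> in \<open>T\<close>, the vertex
    \<open>x\<close> ties \<open>r\<close> to \<open>s\<close> under \<open>f\<close>; this is the
    only constraint that \<open>x\<close> imposes.\<close>
  have Prs: "P z = P y" if "edge_const f (T \<inter> R) P" "P r = P s" "z \<in> V - {u, v, x}" for P z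
    by (rule rest_const[OF c that(1) refl refl refl _ that(3)]) (rule that(2))
  { assume e: "e1 \<in> T" "e2 \<notin> T"
    let ?T = "insert e2 (T - {p})"
    have TE: "?T \<subseteq> E" using c edges_in by auto
    have TR: "?T \<inter> R = T \<inter> R" by (auto simp: R_def)
    have "P x = P v" "P v = P y" "P x = P r" "P u = P s" using P' e t by auto
    then have Prs': "P r \<noteq> P s" using Prs[of P] P(2) P' yrs by metis
    show "con V f' ?T"
    proof (rule con_f'I)
      fix Q assume "edge_const f' ?T Q"
      then have Q: "Q x = Q v" "Q u = Q v" "Q v = Q y" "Q u = Q s" "edge_const f (T \<inter> R) Q"
        using e t ne unfolding edge_const_f'[OF TE] TR by auto
      have "Q r = Q s"
      proof (rule ccontr)
        \<comment> \<open>Both colourings separate \<open>r\<close> from \<open>s\<close>, so, being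
          Boolean, they agree at \<open>r\<close> exactly if they agree at \<open>s\<close>. Thus
          \<open>Prs\<close> applies to the agreement of \<open>P\<close> and
          \<open>Q\<close>.\<close>
        assume ne: "Q r \<noteq> Q s"
        have "edge_const f (T \<inter> R) (\<lambda>z. P z = Q z)"
          using P' Q(5) unfolding edge_const_def by metis
        from Prs[OF this, of r] show False
          using ne Prs' yrs Q \<open>P x = P v\<close> \<open>P v = P y\<close> \<open>P x = P r\<close> by metis
      qed
      then have "\<forall>z\<in>V - {u, v, x}. Q z = Q y" using Prs[OF Q(5)] by blast
      then show "(\<forall>z\<in>V - {u, v, x}. Q z = Q y) \<and> Q u = Q y \<and> Q v = Q y \<and> Q x = Q y"
        using Q(1-3) by blast
    qed }
  { assume e: "e2 \<in> T" "e1 \<notin> T"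
    let ?T = "insert e1 (T - {q})"
    have TE: "?T \<subseteq> E" using c edges_in by auto
    have TR: "?T \<inter> R = T \<inter> R" by (auto simp: R_def)
    have Pe: "P u = P v" "P v = P y" "P x = P r" "P u = P s" using P' e t by auto
    then have Prs': "P r \<noteq> P s" using Prs[of P] P(2) P' yrs by metis
    show "con V f' ?T"
    proof (rule con_f'I)
      fix Q assume "edge_const f' ?T Q"
      then have Q: "Q x = Q v" "Q u = Q v" "Q v = Q y" "Q x = Q r" "edge_const f (T \<inter> R) Q"
        using e t ne unfolding edge_const_f'[OF TE] TR by auto
      have "Q r = Q s"
      proof (rule ccontr)
        assume ne: "Q r \<noteq> Q s"
        have "edge_const f (T \<inter> R) (\<lambda>z. P z = Q z)"
          using P' Q(5) unfolding edge_const_def by metis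
        from Prs[OF this, of r] show False
          using ne Prs' yrs Q Pe by metis
      qed
      then have "\<forall>z\<in>V - {u, v, x}. Q z = Q y" using Prs[OF Q(5)] by blast
      then show "(\<forall>z\<in>V - {u, v, x}. Q z = Q y) \<and> Q u = Q y \<and> Q v = Q y \<and> Q x = Q y"
        using Q(1-3) by blast
    qed }
qed

text \<open>If \<open>T\<close> misses \<open>p\<close> or \<open>q\<close>, then {u, v} and
  \<open>x\<close> each hang on the rest by one edge under \<open>f\<close>, so the rest is
  connected by itself and only \<open>u\<close>, \<open>v\<close>, \<open>x\<close> must be
  reattached. Keeping \<open>T\<close> would isolate \<open>u\<close> under \<open>f'\<close> for
  the trace \<open>e1\<close>, \<open>p\<close>, and \<open>x\<close> for the trace
  \<open>e2\<close>, \<open>q\<close>.\<close>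

lemma \<phi>_tree:
  assumes T: "T \<in> trees V f E" shows "\<phi> T \<in> trees V f' E" "h \<in> \<phi> T"
proof -
  have TE: "T \<subseteq> E" and c: "con V f T" and cT: "card T + 1 = card V" using T by (auto simp: trees_def)
  note t = tree_meets[OF c TE] tree_not_both[OF T]
  have fT: "finite T" using TE fin finite_subset by blast
  show "h \<in> \<phi> T" using t(1) ne by (auto simp: \<phi>_def)
  have sub: "\<phi> T \<subseteq> E" using TE edges_in by (auto simp: \<phi>_def)
  have card: "card (\<phi> T) = card T"
    using t card_exchange[OF fT] ne by (auto simp: \<phi>_def)
  have R: "\<phi> T \<inter> R = T \<inter> R" by (auto simp: \<phi>_def R_def)
  have "con V f' (\<phi> T)"
  proof (cases "p \<in> T \<and> q \<in> T")
    case True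
    then show ?thesis using con_exchange[OF c TE _ t(1)] t by (auto simp: \<phi>_def)
  next
    case False
    show ?thesis
    proof (rule con_f'I)
      fix P assume "edge_const f' (\<phi> T) P"
      note P = this[unfolded edge_const_f'[OF sub] R]
      \<comment> \<open>Under \<open>f\<close>, \<open>u\<close> and \<open>v\<close> may take the
        colour of \<open>y\<close>, and \<open>x\<close> that of its only neighbour in
        \<open>T\<close>.\<close>
      have J: "P z = P y" if "z \<in> V - {u, v, x}" for z
        by (rule rest_const[OF c TE _ refl refl, of P "if p \<in> T then P r else P s"])
          (use P False that in auto)
      have "P r = P y" "P s = P y" by (rule J, fact yrs)+
      consider "e1 \<in> T" "e2 \<notin> T" "p \<in> T" "q \<notin> T" | "e1 \<in> T" "e2 \<notin> T" "p \<notin> T" "q \<in> T"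
        | "e1 \<notin> T" "e2 \<in> T" "p \<in> T" "q \<notin> T" | "e1 \<notin> T" "e2 \<in> T" "p \<notin> T" "q \<in> T"
        using t False by blast
      then have "P u = P y \<and> P v = P y \<and> P x = P y"
        by cases (use P t(1) \<open>P r = P y\<close> \<open>P s = P y\<close> ne in \<open>simp_all add: \<phi>_def, blast?\<close>)
      then show "(\<forall>z\<in>V - {u, v, x}. P z = P y) \<and> P u = P y \<and> P v = P y \<and> P x = P y"
        using J by blast
    qed
  qed
  then show "\<phi> T \<in> trees V f' E" using sub card cT by (auto simp: trees_def)
qed

text \<open>Source of the strict inequality: under \<open>f\<close> only \<open>h\<close> leaves {u,
  v}, so all trees and their images contain it, while under \<open>f'\<close> the edges
  \<open>e1\<close> and \<open>q\<close> leave {u, v} as well.\<close>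

lemma tree_avoiding_h:
  obtains S where "S \<in> trees V f' E" "h \<notin> S"
proof -
  have sub: "E - {h} \<subseteq> E" by auto
  have R: "(E - {h}) \<inter> R = R" "E \<inter> R = R" by (auto simp: R_def)
  have "con V f' (E - {h})"
  proof (rule con_f'I)
    fix P assume "edge_const f' (E - {h}) P"
    note P = this[unfolded edge_const_f'[OF sub] R]
    \<comment> \<open>\<open>P r = P s\<close> holds because \<open>p\<close>, \<open>e1\<close>,
      \<open>e2\<close>, \<open>q\<close> now form a walk from \<open>r\<close> over
      \<open>x\<close>, \<open>v\<close>, \<open>u\<close> to \<open>s\<close>.\<close>
    have J: "P z = P y" if "z \<in> V - {u, v, x}" for z
      by (rule rest_const[OF con_E subset_refl _ refl refl, of P "P r"])
        (use P R edges_in ne that in auto)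
    have "P x = P v \<and> P u = P v \<and> P x = P r" using P edges_in ne by blast
    with J[OF yrs(2)] have "P u = P y \<and> P v = P y \<and> P x = P y" by blast
    then show "(\<forall>z\<in>V - {u, v, x}. P z = P y) \<and> P u = P y \<and> P v = P y \<and> P x = P y"
      using J by blast
  qed
  moreover have "size (f' e) = 2 \<and> set_mset (f' e) \<subseteq> V" if "e \<in> E" for e
    using size_f[OF that] f_in[OF that] uvx yrs by (auto simp: f'_def)
  ultimately obtain S where "S \<in> trees V f' (E - {h})"
    using con_imp_tree[of V "E - {h}" f'] fin by auto
  then show thesis using that by (auto simp: trees_def)
qed

theorem card_trees_less: "card (trees V f E) < card (trees V f' E)"
proof -
  obtain S where S: "S \<in> trees V f' E" "h \<notin> S" using tree_avoiding_h .
  have "inj_on \<phi> (trees V f E)" by (rule inj_on_inverseI[of _ \<phi>_inv]) (rule \<phi>_inv)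
  then have "card (trees V f E) = card (\<phi> ` trees V f E)" by (simp add: card_image)
  also have "\<phi> ` trees V f E \<subset> trees V f' E" using \<phi>_tree S by blast
  then have "card (\<phi> ` trees V f E) < card (trees V f' E)"
    by (rule psubset_card_mono[rotated]) (rule finite_trees[OF fin(2)])
  finally show ?thesis .
qed

end

section \<open>Excluding parallel edges in a maximal graph\<close>

lemma extremal_incident:
  assumes ex: "extremal g G" "3 \<le> g" and v: "v \<in> verts G"
  shows "card {e \<in> edges G. v \<in># ends G e} = 3"
proof -
  interpret weighted_multigraph G by (rule stable_con_wm[OF extremalD[OF ex(1)]])
  have one: "count (ends G e) v = (if v \<in># ends G e then 1 else 0)" if e: "e \<in> edges G" for e
  proof (cases "v \<in># ends G e")
    case True
    then obtain b where "ends G e = {#v, b#}" using obtain_ends_at[OF e] by metis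
    then show ?thesis using extremal_loopless[OF ex e, of v] by auto
  qed (simp add: count_eq_zero_iff)
  have "degree G v = (\<Sum>e\<in>edges G. if v \<in># ends G e then 1 else 0)"
    unfolding degree_def by (rule sum.cong) (use one in auto)
  also have "\<dots> = card {e \<in> edges G. v \<in># ends G e}"
    using finite_edges by (simp add: sum.If_cases Int_def)
  finally show ?thesis using extremal_trivalent(2)[OF ex v] by simp
qed

lemma card_3_third:
  assumes "card A = 3" "a \<in> A" "b \<in> A" "a \<noteq> b"
  obtains c where "A = {a, b, c}" "c \<noteq> a" "c \<noteq> b"
proof -
  have "finite A" using assms(1) card.infinite by fastforce
  then have "card (A - {a, b}) = 1" using assms by (simp add: card_Diff_subset)
  then obtain c where c: "A - {a, b} = {c}" by (auto simp: card_1_singleton_iff)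
  then have "A = {a, b, c}" "c \<noteq> a" "c \<noteq> b" using assms by auto
  then show thesis by (rule that)
qed

lemma card_3_others:
  assumes "card A = 3" "a \<in> A"
  obtains b c where "A = {a, b, c}" "b \<noteq> a" "c \<noteq> a" "b \<noteq> c"
proof -
  have "finite A" using assms(1) card.infinite by fastforce
  then have "card (A - {a}) = 2" using assms by simp
  then obtain b c where bc: "A - {a} = {b, c}" "b \<noteq> c" by (auto simp: card_2_iff)
  then have "A = {a, b, c}" "b \<noteq> a" "c \<noteq> a" using assms by auto
  then show thesis using that bc(2) by blast
qed

text \<open>Here \<open>d\<close> is the third edge at \<open>u\<close>. Most of the work shows that
  the neighbourhood is in the general position required by \<open>parallel_switch\<close>;
  degenerate positions give a theta graph or a bridge.\<close>

lemma extremal_no_parallel: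
  assumes ex: "extremal g G" "3 \<le> g" and e: "e1 \<in> edges G" "e2 \<in> edges G" "e1 \<noteq> e2"
    and par: "ends G e1 = ends G e2"
  shows False
proof -
  note st = extremalD[OF ex(1)]
  interpret weighted_multigraph G by (rule stable_con_wm[OF st])
  let ?V = "verts G" and ?E = "edges G" and ?f = "ends G"
  have fin: "finite ?V" "finite ?E" by (rule finite_verts finite_edges)+
  define I where "I w = {e \<in> ?E. w \<in># ?f e}" for w
  have I3: "card (I w) = 3" if "w \<in> ?V" for w
    using extremal_incident[OF ex that] by (simp add: I_def)
  have inI: "e \<in> I w \<longleftrightarrow> e \<in> ?E \<and> w \<in># ?f e" for e w by (simp add: I_def)
  note loopless = extremal_loopless[OF ex]
  obtain u v where uv: "?f e1 = {#u, v#}" "u \<in> ?V" "v \<in> ?V" using obtain_ends[OF e(1)] .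
  have uv2: "?f e2 = {#u, v#}" using uv par by simp
  have unv: "u \<noteq> v" using loopless[OF e(1), of u] uv by auto
  obtain d where Iu: "I u = {e1, e2, d}" and d: "d \<noteq> e1" "d \<noteq> e2"
    using card_3_third[OF I3[OF uv(2)], of e1 e2] e uv uv2 by (auto simp: inI)
  obtain h where Iv: "I v = {e1, e2, h}" and h: "h \<noteq> e1" "h \<noteq> e2"
    using card_3_third[OF I3[OF uv(3)], of e1 e2] e uv uv2 by (auto simp: inI)
  have dE: "d \<in> ?E" "u \<in># ?f d" and hE: "h \<in> ?E" "v \<in># ?f h" using Iu Iv inI by blast+
  obtain x where x: "?f d = {#u, x#}" "x \<in> ?V" using obtain_ends_at[OF dE] .
  obtain y where y: "?f h = {#v, y#}" "y \<in> ?V" using obtain_ends_at[OF hE] .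
  have xu: "x \<noteq> u" using loopless[OF dE(1)] x by auto
  have yv: "y \<noteq> v" using loopless[OF hE(1)] y by auto
  \<comment> \<open>If the third edge also ends at \<open>v\<close>, the whole graph is the theta
    graph, of genus 3 - 2 + 1 = 2.\<close>
  have xv: "x \<noteq> v"
  proof
    assume "x = v"
    then have "d \<in> I v" using dE x by (simp add: inI)
    then have dh: "d = h" using Iv d by auto
    have "edge_const ?f ?E (\<lambda>z. z \<in> {u, v})"
      unfolding edge_const_def
    proof (intro ballI)
      fix c a b assume c: "c \<in> ?E" "a \<in># ?f c" "b \<in># ?f c"
      show "(a \<in> {u, v}) = (b \<in> {u, v})"
      proof (cases "c \<in> I u \<union> I v")
        case True
        then have "c \<in> {e1, e2, d}" using Iu Iv dh by auto
        then have "?f c = {#u, v#}" using uv uv2 x \<open>x = v\<close> by auto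
        then show ?thesis using c by auto
      next
        case False then show ?thesis using c by (auto simp: inI)
      qed
    qed
    from conD[OF stable_con_con[OF st] this uv(2)] have V: "?V = {u, v}" using uv by auto
    have "?E = {e1, e2, d}"
    proof
      show "?E \<subseteq> {e1, e2, d}"
      proof
        fix c assume c: "c \<in> ?E"
        obtain a b where "?f c = {#a, b#}" "a \<in> ?V" using obtain_ends[OF c] .
        then have "c \<in> I u \<union> I v" using V c by (auto simp: inI)
        then show "c \<in> {e1, e2, d}" using Iu Iv dh by auto
      qed
    qed (use e dE in auto)
    then have "card ?E = 3" using d e by simp
    moreover have "weight G u = 0" "weight G v = 0" using extremal_trivalent(1)[OF ex] uv by auto
    ultimately have "g = 2" using st V unv by (simp add: stable_con_def)
    then show False using ex by simp
  qed
  have dv: "d \<notin> I v" using x xv unv by (auto simp: inI)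
  then have dh: "d \<noteq> h" using Iv by auto
  have yu: "y \<noteq> u"
  proof
    assume "y = u"
    then have "h \<in> I u" using hE y by (simp add: inI)
    then show False using Iu h dh by auto
  qed
  have dx: "d \<in> I x" using dE x by (simp add: inI)
  have notx: "e1 \<notin> I x" "e2 \<notin> I x" using uv uv2 xu xv by (auto simp: inI)
  \<comment> \<open>If \<open>x\<close> equals \<open>y\<close>, the only edge leaving {u, v, x} is
    the third edge \<open>z\<close> at \<open>x\<close>, a bridge.\<close>
  have yx: "y \<noteq> x"
  proof
    assume "y = x"
    then have hx: "h \<in> I x" using hE y by (simp add: inI)
    obtain z where Ix: "I x = {d, h, z}" "z \<noteq> d" "z \<noteq> h" using card_3_third[OF I3[OF x(2)] dx hx dh] .
    then have z: "z \<in> ?E" "x \<in># ?f z" "z \<noteq> e1" "z \<noteq> e2" using inI notx by blast+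
    obtain c where c: "?f z = {#x, c#}" "c \<in> ?V" using obtain_ends_at[OF z(1,2)] .
    have "edge_const ?f (?E - {z}) (\<lambda>w. w \<in> {u, v, x})"
      unfolding edge_const_def
    proof (intro ballI)
      fix k a b assume k: "k \<in> ?E - {z}" "a \<in># ?f k" "b \<in># ?f k"
      show "(a \<in> {u, v, x}) = (b \<in> {u, v, x})"
      proof (cases "k \<in> I u \<union> I v \<union> I x")
        case True
        then have "k \<in> {e1, e2, d, h}" using Iu Iv Ix k by auto
        then show ?thesis using k uv uv2 x y \<open>y = x\<close> by auto
      next
        case False then show ?thesis using k by (auto simp: inI)
      qed
    qed
    from conD[OF extremal_bridgeless[OF ex z(1)] this x(2) c(2)] have "c \<in> {u, v, x}" by simp
    moreover have "c \<noteq> x" using loopless[OF z(1), of x] c by auto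
    moreover have "c \<noteq> u" using c z Iu Ix inI[of z u] by auto
    moreover have "c \<noteq> v" using c z Iv Ix inI[of z v] by auto
    ultimately show False by blast
  qed
  obtain p q where Ix: "I x = {d, p, q}" "p \<noteq> d" "q \<noteq> d" "p \<noteq> q" using card_3_others[OF I3[OF x(2)] dx] .
  have pE: "p \<in> ?E" "x \<in># ?f p" and qE: "q \<in> ?E" "x \<in># ?f q" using Ix inI by blast+
  obtain r where r: "?f p = {#x, r#}" "r \<in> ?V" using obtain_ends_at[OF pE] .
  obtain s where s: "?f q = {#x, s#}" "s \<in> ?V" using obtain_ends_at[OF qE] .
  have hx: "h \<notin> I x" using y yx xv by (auto simp: inI)
  have far: "t \<notin> {u, v, x}" if "k \<in> I x" "k \<noteq> d" "?f k = {#x, t#}" for k t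
  proof -
    have k: "k \<in> ?E" "k \<noteq> e1" "k \<noteq> e2" "k \<noteq> h" using that notx hx by (auto simp: inI)
    have "t \<noteq> x" using loopless[OF k(1)] that by auto
    moreover have "t \<noteq> u" using inI[of k u] k Iu that by auto
    moreover have "t \<noteq> v" using inI[of k v] k Iv that by auto
    ultimately show ?thesis by simp
  qed
  have pd: "p \<noteq> e1" "p \<noteq> e2" "p \<noteq> h" and qd: "q \<noteq> e1" "q \<noteq> e2" "q \<noteq> h" using Ix notx hx by auto
  interpret S: parallel_switch ?V "?E - {d}" ?f e1 e2 h p q u v x y r s
  proof
    show "r \<in> ?V - {u, v, x}" "s \<in> ?V - {u, v, x}" using far[of p r] far[of q s] Ix r s by auto
    show "con ?V ?f (?E - {d})" by (rule extremal_bridgeless[OF ex dE(1)])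
    show "set_mset (?f e) \<inter> {u, v, x} = {}" if "e \<in> ?E - {d} - {e1, e2, h, p, q}" for e
    proof -
      have "e \<notin> I u" "e \<notin> I v" "e \<notin> I x" using that Iu Iv Ix by auto
      then show ?thesis using that by (auto simp: inI)
    qed
    show "distinct [e1, e2, h, p, q]" using e h pd qd Ix by auto
  qed (use fin size_ends ends_in_verts e d dh hE pE qE Ix unv xu xv uv x y yu yv yx uv2 r s in auto)
  let ?f' = "S.f'"
  define G' where "G' = G\<lparr>ends := ?f'\<rparr>"
  have f'd: "?f' d = ?f d" using d Ix by (simp add: S.f'_rest)
  have Ed: "insert d (?E - {d}) = ?E" using dE by auto
  have sz: "size (?f' k) = 2 \<and> set_mset (?f' k) \<subseteq> ?V" if "k \<in> ?E" for k
    using size_ends[OF that] ends_in_verts[OF that] uv x s by (auto simp: S.f'_def)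
  have wm: "weighted_multigraph G'"
    by unfold_locales (use fin sz in \<open>auto simp: G'_def\<close>)
  have "card (trees ?V ?f (insert d (?E - {d}))) = card (trees ?V ?f (?E - {d})) +
      card (trees (?V - {x}) (\<lambda>k. image_mset (id(x := u)) (?f k)) (?E - {d}))"
    by (rule card_trees_insert) (use fin x uv xu in auto)
  moreover have "card (trees ?V ?f' (insert d (?E - {d}))) = card (trees ?V ?f' (?E - {d})) +
      card (trees (?V - {x}) (\<lambda>k. image_mset (id(x := u)) (?f' k)) (?E - {d}))"
    by (rule card_trees_insert) (use fin x uv xu f'd in auto)
  \<comment> \<open>Once \<open>x\<close> is identified with \<open>u\<close>, the exchange of ends
    is invisible.\<close>
  moreover have "trees (?V - {x}) (\<lambda>k. image_mset (id(x := u)) (?f' k)) (?E - {d}) =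
      trees (?V - {x}) (\<lambda>k. image_mset (id(x := u)) (?f k)) (?E - {d})"
  proof (rule trees_cong)
    fix k
    show "image_mset (id(x := u)) (?f' k) = image_mset (id(x := u)) (?f k)"
      by (cases "k = e1"; cases "k = q") (use S.f' S.f xu xv in \<open>auto simp: S.f'_rest\<close>)
  qed
  ultimately have less: "complexity G < complexity G'"
    using S.card_trees_less Ed complexity_eq weighted_multigraph.complexity_eq[OF wm]
    by (simp add: G'_def)
  then have "trees ?V ?f' ?E \<noteq> {}"
    using weighted_multigraph.complexity_eq[OF wm] by (auto simp: G'_def)
  then have con': "con (verts G') (ends G') (edges G')"
    using con_mono by (fastforce simp: trees_def G'_def)
  have "degree G' w = degree G w" for w
  proof -
    have e1q: "e1 \<in> ?E" "q \<in> ?E - {e1}" using e qE qd by auto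
    have "degree G' w = count (?f' e1) w + (count (?f' q) w + (\<Sum>k\<in>?E - {e1} - {q}. count (?f' k) w))"
      unfolding degree_def G'_def using e1q fin by (simp add: sum.remove[of _ e1] sum.remove[of _ q])
    also have "(\<Sum>k\<in>?E - {e1} - {q}. count (?f' k) w) = (\<Sum>k\<in>?E - {e1} - {q}. count (?f k) w)"
      by (rule sum.cong) (auto simp: S.f'_rest)
    also have "count (?f' e1) w + (count (?f' q) w + (\<Sum>k\<in>?E - {e1} - {q}. count (?f k) w)) =
        count (?f e1) w + (count (?f q) w + (\<Sum>k\<in>?E - {e1} - {q}. count (?f k) w))"
      unfolding S.f' S.f by simp
    also have "\<dots> = degree G w"
      unfolding degree_def using e1q fin by (simp add: sum.remove[of _ e1] sum.remove[of _ q])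
    finally show ?thesis .
  qed
  then have "stable_con g G'"
    using stable_con_transfer[OF st wm con'] st by (simp add: G'_def stable_con_def)
  then show False using less extremal_not_less[OF ex(1)] by blast
qed

section \<open>Relabelling\<close>

text \<open>The given graph has arbitrary label types while its competitors live on
  \<open>nat\<close>; an injective copy makes it one of them, and the properties are read back from
  the copy.\<close>

locale graph_relabelling = weighted_multigraph G
  for G :: "('v, 'e) wmgraph" +
  fixes \<phi> :: "'v \<Rightarrow> 'w" and \<psi> :: "'e \<Rightarrow> 'f"
  assumes inj_\<phi>: "inj_on \<phi> (verts G)" and inj_\<psi>: "inj_on \<psi> (edges G)"
begin

definition relabel :: "('w, 'f) wmgraph" where
  "relabel = \<lparr>verts = \<phi> ` verts G, edges = \<psi> ` edges G,
    ends = (\<lambda>j. image_mset \<phi> (ends G (inv_into (edges G) \<psi> j))),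
    weight = (\<lambda>j. weight G (inv_into (verts G) \<phi> j))\<rparr>"

lemma verts_relabel: "verts relabel = \<phi> ` verts G" and edges_relabel: "edges relabel = \<psi> ` edges G"
  by (simp_all add: relabel_def)

lemma ends_relabel: "e \<in> edges G \<Longrightarrow> ends relabel (\<psi> e) = image_mset \<phi> (ends G e)"
  by (simp add: relabel_def inv_into_f_f[OF inj_\<psi>])

lemma weight_relabel: "v \<in> verts G \<Longrightarrow> weight relabel (\<phi> v) = weight G v"
  by (simp add: relabel_def inv_into_f_f[OF inj_\<phi>])

lemma wm_relabel: "weighted_multigraph relabel"
proof
  fix j assume "j \<in> edges relabel"
  then obtain e where "e \<in> edges G" "j = \<psi> e" by (auto simp: edges_relabel)
  then show "size (ends relabel j) = 2" "set_mset (ends relabel j) \<subseteq> verts relabel"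
    using size_ends[of e] ends_in_verts[of e] by (auto simp: ends_relabel verts_relabel)
qed (auto simp: relabel_def finite_verts finite_edges)

lemma con_relabel:
  assumes T: "T \<subseteq> edges G" shows "con (verts relabel) (ends relabel) (\<psi> ` T) \<longleftrightarrow> con (verts G) (ends G) T"
proof -
  have ec: "edge_const (ends relabel) (\<psi> ` T) P \<longleftrightarrow> edge_const (ends G) T (\<lambda>x. P (\<phi> x))" for P
  proof -
    have "ends relabel (\<psi> e) = image_mset \<phi> (ends G e)" if "e \<in> T" for e using ends_relabel that T by auto
    then show ?thesis by (simp add: edge_const_def)
  qed
  show ?thesis
  proof
    assume c: "con (verts relabel) (ends relabel) (\<psi> ` T)"
    then obtain a where a: "a \<in> verts G" by (auto simp: con_def verts_relabel)
    show "con (verts G) (ends G) T"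
    proof (rule conI[OF a])
      fix P x assume P: "edge_const (ends G) T P" and x: "x \<in> verts G"
      let ?Q = "\<lambda>z. P (inv_into (verts G) \<phi> z)"
      have Q: "?Q (\<phi> z) = P z" if "z \<in> verts G" for z by (simp add: inv_into_f_f[OF inj_\<phi> that])
      have "edge_const (ends G) T (\<lambda>x. ?Q (\<phi> x))"
        unfolding edge_const_def
      proof (intro ballI)
        fix e i j assume e: "e \<in> T" "i \<in># ends G e" "j \<in># ends G e"
        then have "i \<in> verts G" "j \<in> verts G" using ends_in_verts T by blast+
        moreover have "P i = P j" using P e unfolding edge_const_def by blast
        ultimately show "?Q (\<phi> i) = ?Q (\<phi> j)" by (simp add: Q)
      qed
      then have "edge_const (ends relabel) (\<psi> ` T) ?Q" by (simp only: ec)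
      from conD[OF c this, of "\<phi> x" "\<phi> a"] show "P x = P a" using Q x a by (simp add: verts_relabel)
    qed
  next
    assume c: "con (verts G) (ends G) T"
    then obtain a where a: "a \<in> verts G" by (auto simp: con_def)
    show "con (verts relabel) (ends relabel) (\<psi> ` T)"
    proof (rule conI[of "\<phi> a"])
      fix P x assume "edge_const (ends relabel) (\<psi> ` T) P" and "x \<in> verts relabel"
      then obtain z where "edge_const (ends G) T (\<lambda>x. P (\<phi> x))" "z \<in> verts G" "x = \<phi> z"
        by (auto simp: ec verts_relabel)
      then show "P x = P (\<phi> a)" using conD[OF c _ _ a] by metis
    qed (use a in \<open>simp add: verts_relabel\<close>)
  qed
qed

lemma degree_relabel: "v \<in> verts G \<Longrightarrow> degree relabel (\<phi> v) = degree G v"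
proof -
  assume v: "v \<in> verts G"
  have ct: "count (ends relabel (\<psi> e)) (\<phi> v) = count (ends G e) v" if e: "e \<in> edges G" for e
  proof -
    obtain a b where ab: "ends G e = {#a, b#}" "a \<in> verts G" "b \<in> verts G" using obtain_ends[OF e] .
    then have "\<phi> a = \<phi> v \<longleftrightarrow> a = v" "\<phi> b = \<phi> v \<longleftrightarrow> b = v"
      using inj_\<phi> v by (auto dest: inj_onD)
    then show ?thesis using ends_relabel[OF e] ab by auto
  qed
  show "degree relabel (\<phi> v) = degree G v"
    unfolding degree_def edges_relabel sum.reindex[OF inj_\<psi>] by (rule sum.cong) (use ct in auto)
qed

lemma complexity_relabel: "complexity relabel = complexity G"
proof -
  have card: "card (\<psi> ` T) = card T" if "T \<subseteq> edges G" for T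
    using that inj_\<psi> by (meson card_image inj_on_subset)
  have cV: "card (verts relabel) = card (verts G)" using inj_\<phi> by (simp add: verts_relabel card_image)
  have "trees (verts relabel) (ends relabel) (edges relabel) = (`) \<psi> ` trees (verts G) (ends G) (edges G)"
  proof (rule set_eqI)
    fix S
    have "S \<in> trees (verts relabel) (ends relabel) (edges relabel) \<longleftrightarrow> (\<exists>T\<subseteq>edges G. S = \<psi> ` T \<and>
      con (verts relabel) (ends relabel) (\<psi> ` T) \<and> card (\<psi> ` T) + 1 = card (verts G))"
      unfolding trees_def edges_relabel cV by (auto simp: subset_image_iff)
    also have "\<dots> \<longleftrightarrow> (\<exists>T\<subseteq>edges G. S = \<psi> ` T \<and> con (verts G) (ends G) T \<and> card T + 1 = card (verts G))"
      using con_relabel card by metis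
    finally show "S \<in> trees (verts relabel) (ends relabel) (edges relabel) \<longleftrightarrow>
      S \<in> (`) \<psi> ` trees (verts G) (ends G) (edges G)" unfolding trees_def by blast
  qed
  moreover have "inj_on ((`) \<psi>) (trees (verts G) (ends G) (edges G))"
    by (rule inj_on_subset[OF inj_on_image_Pow[OF inj_\<psi>]]) (auto simp: trees_def)
  ultimately show ?thesis
    using complexity_eq weighted_multigraph.complexity_eq[OF wm_relabel] by (simp add: card_image)
qed

lemma stable_con_relabel: "stable_con g G \<Longrightarrow> stable_con g relabel"
proof -
  assume st: "stable_con g G"
  have "card (edges relabel) = card (edges G)" "card (verts relabel) = card (verts G)"
    using inj_\<phi> inj_\<psi> by (simp_all add: verts_relabel edges_relabel card_image)
  moreover have "(\<Sum>v\<in>verts relabel. weight relabel v) = (\<Sum>v\<in>verts G. weight G v)"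
    unfolding verts_relabel sum.reindex[OF inj_\<phi>] by (rule sum.cong) (auto simp: weight_relabel)
  moreover have "con (verts relabel) (ends relabel) (edges relabel)"
    using con_relabel[of "edges G"] st by (simp add: stable_con_def edges_relabel)
  moreover have "\<forall>v\<in>verts relabel. 3 \<le> 2 * weight relabel v + degree relabel v"
    using st by (auto simp: stable_con_def verts_relabel weight_relabel degree_relabel)
  ultimately show "stable_con g relabel" using st wm_relabel by (simp add: stable_con_def)
qed

end

text \<open>A competitor with positive complexity: it forces a maximal graph to have a spanning
  tree, hence to be connected.\<close>

lemma stable_con_point:
  assumes "2 \<le> g"
  defines "G \<equiv> \<lparr>verts = {0 :: nat}, edges = {} :: nat set, ends = \<lambda>_. {#}, weight = \<lambda>_. nat g\<rparr>"
  shows "stable_con g G" "0 < complexity G"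
proof -
  have wm: "weighted_multigraph G" by unfold_locales (auto simp: G_def)
  have c: "con (verts G) (ends G) (edges G)" by (simp add: G_def con_def)
  then show "stable_con g G" using assms wm by (simp add: stable_con_def G_def degree_def)
  have "{} \<in> trees (verts G) (ends G) (edges G)" using c by (simp add: trees_def G_def)
  then show "0 < complexity G"
    using weighted_multigraph.complexity_eq[OF wm] finite_trees[of "edges G"]
    by (auto simp: G_def card_gt_0_iff)
qed

section \<open>Transfer of the results to arbitrary labels\<close>

theorem theorem3p9:
  fixes g :: int and \<Gamma> :: "('v, 'e) wmgraph"
  assumes "g \<ge> 3"
    and "\<Gamma> \<in> stable_graphs g"
    and "\<forall>\<Gamma>' \<in> (stable_graphs g :: (nat, nat) wmgraph set). complexity \<Gamma> \<ge> complexity \<Gamma>'"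
  shows "trivalent \<Gamma> \<and> simple_graph \<Gamma> \<and> k_connected 2 \<Gamma>"
proof -
  interpret weighted_multigraph \<Gamma> using assms(2) by (simp add: stable_graphs_def)
  have "0 < complexity \<Gamma>"
    using stable_con_point[of g] assms(1,3) by (fastforce simp: stable_con_iff)
  then have "trees (verts \<Gamma>) (ends \<Gamma>) (edges \<Gamma>) \<noteq> {}" by (auto simp: complexity_eq)
  then have "con (verts \<Gamma>) (ends \<Gamma>) (edges \<Gamma>)" using con_mono by (auto simp: trees_def)
  then have st: "stable_con g \<Gamma>" using assms(2) by (simp add: stable_con_iff graph_connected_iff)
  obtain \<phi> :: "'v \<Rightarrow> nat" where \<phi>: "inj_on \<phi> (verts \<Gamma>)"
    using finite_verts finite_imp_inj_to_nat_seg by blast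
  obtain \<psi> :: "'e \<Rightarrow> nat" where \<psi>: "inj_on \<psi> (edges \<Gamma>)"
    using finite_edges finite_imp_inj_to_nat_seg by blast
  interpret graph_relabelling \<Gamma> \<phi> \<psi> using \<phi> \<psi> by unfold_locales
  \<comment> \<open>The copy has the same complexity as the original, so the assumed bound for
    graphs on \<open>nat\<close> makes it extremal.\<close>
  have "extremal g relabel"
    using stable_con_relabel[OF st] assms(3) by (simp add: extremal_def complexity_relabel stable_con_iff)
  note ex = this assms(1)
  have "trivalent \<Gamma>"
    unfolding trivalent_def
  proof
    fix v assume "v \<in> verts \<Gamma>"
    then show "degree \<Gamma> v = 3"
      using extremal_trivalent(2)[OF ex, of "\<phi> v"] degree_relabel[of v] by (simp add: verts_relabel)
  qed
  moreover have "simple_graph \<Gamma>"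
    unfolding simple_graph_def
  proof (intro conjI ballI allI inj_onI)
    fix e v assume "e \<in> edges \<Gamma>"
    then show "ends \<Gamma> e \<noteq> {#v, v#}"
      using extremal_loopless[OF ex, of "\<psi> e" "\<phi> v"] ends_relabel[of e] by (auto simp: edges_relabel)
  next
    fix d e assume de: "d \<in> edges \<Gamma>" "e \<in> edges \<Gamma>" "ends \<Gamma> d = ends \<Gamma> e"
    then have "\<psi> d = \<psi> e"
      using extremal_no_parallel[OF ex, of "\<psi> d" "\<psi> e"] by (auto simp: edges_relabel ends_relabel)
    then show "d = e" using \<psi> de by (auto dest: inj_onD)
  qed
  moreover have "k_connected 2 \<Gamma>"
    unfolding k_connected_def
  proof (intro allI impI)
    fix S assume S: "S \<subseteq> edges \<Gamma>" "card S = 2 - 1"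
    then obtain e where e: "S = {e}" "e \<in> edges \<Gamma>" by (auto simp: card_1_singleton_iff)
    have "\<psi> ` (edges \<Gamma> - {e}) = edges relabel - {\<psi> e}"
      using \<psi> e by (auto simp: edges_relabel dest: inj_onD)
    then have "con (verts \<Gamma>) (ends \<Gamma>) (edges \<Gamma> - {e})"
      using extremal_bridgeless[OF ex, of "\<psi> e"] con_relabel[of "edges \<Gamma> - {e}"] e by (auto simp: edges_relabel)
    then show "graph_connected (delete_edges \<Gamma> S)"
      using weighted_multigraph.graph_connected_iff[OF weighted_multigraph_subset[of "edges \<Gamma> - S"]] e
      by (simp add: delete_edges_def)
  qed
  ultimately show ?thesis by blast
qed

end
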